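(* Let $\mathbb{H}=\{(z_1,z_2)\in\mathbb{C}^2 : |z_1|<|z_2|<1\}$ be the Hartogs triangle. The operator $\mathbf{F}^2=\mathbf{F}\circ\mathbf{F}$ is bounded on $A^p(\mathbb{H})$ for all $p\in[2,\infty]$ (with $A^\infty$ replaced by $H^\infty(\mathbb{H})$ when $p=\infty$). Indeed: (1) $\mathbf{F}^2:A^2(\mathbb{H})\to A^p(\mathbb{H})$ is bounded for all $p\in[2,4)$; (2) $\mathbf{F}^2:A^4(\mathbb{H})\to A^p(\mathbb{H})$ is bounded for all $p\in[4,\infty]$ (when $p=\infty$, the target space is $H^\infty(\mathbb{H})$). In either case there is a constant $C_p>0$ such that $\|\mathbf{F}^2(f)\|_{L^p(\mathbb{H})}\le C_p\|f\|_{L^1(\mathbb{H})}$ for all $f$ in the respective domain space ($A^2(\mathbb{H})$ in (1), $A^4(\mathbb{H})$ in (2)).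
   Context: For a bounded domain $\Omega\subset\mathbb{C}^n$, $\mathcal{O}(\Omega)$ is the space of holomorphic functions on $\Omega$; for $1\le p<\infty$, $A^p(\Omega)=L^p(\Omega)\cap\mathcal{O}(\Omega)$ (with respect to Lebesgue measure, with the $L^p$ norm), and $H^\infty(\Omega)=L^\infty(\Omega)\cap\mathcal{O}(\Omega)$. The Bergman projection $\mathbf{B}$ is the orthogonal projection from $L^2(\Omega)$ onto $A^2(\Omega)$. The Friedrichs operator is the conjugate-linear map $\mathbf{F}:A^2(\Omega)\to A^2(\Omega)$, $\mathbf{F}(g)=\mathbf{B}(\overline{g})$, and $\mathbf{F}^2=\mathbf{F}\circ\mathbf{F}$ is complex-linear. An operator $T:X\to Y$ is bounded if it maps $X$ into $Y$ with $\|Tx\|_Y\le C\|x\|_X$ for some constant $C$ and all $x\in X$. *)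

theory Defs
  imports "HOL-Analysis.Analysis" "HOL-Probability.Essential_Supremum"
begin

text \<open>
  Functions on \<open>\<Omega> \<subseteq> \<complex>\<^sup>n\<close> are total functions whose values outside \<open>\<Omega>\<close> are ignored;
  exponents \<open>p \<in> [1, \<infinity>]\<close> are extended reals.
\<close>

text \<open>Holomorphic on an open set: Frechet differentiable with complex-linear derivative.\<close>

definition holomorphic_fun_on :: "(complex^'n \<Rightarrow> complex) \<Rightarrow> (complex^'n) set \<Rightarrow> bool" where
  "holomorphic_fun_on f \<Omega> \<longleftrightarrow>
     (\<forall>z\<in>\<Omega>. \<exists>D. (f has_derivative D) (at z) \<and> (\<forall>c v. D (c *s v) = c * D v))"

definition lp_space :: "ereal \<Rightarrow> (complex^'n) set \<Rightarrow> (complex^'n \<Rightarrow> complex) set" where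
  "lp_space p \<Omega> = {f \<in> borel_measurable (lebesgue_on \<Omega>).
     if p = \<infinity> then esssup (lebesgue_on \<Omega>) (\<lambda>z. ereal (norm (f z))) < \<infinity>
     else integrable (lebesgue_on \<Omega>) (\<lambda>z. norm (f z) powr real_of_ereal p)}"

text \<open>Only meaningful for members of \<^term>\<open>lp_space p \<Omega>\<close>.\<close>

definition lp_norm :: "ereal \<Rightarrow> (complex^'n) set \<Rightarrow> (complex^'n \<Rightarrow> complex) \<Rightarrow> real" where
  "lp_norm p \<Omega> f =
     (if p = \<infinity> then real_of_ereal (esssup (lebesgue_on \<Omega>) (\<lambda>z. ereal (norm (f z))))
      else (LINT z|lebesgue_on \<Omega>. norm (f z) powr real_of_ereal p) powr (1 / real_of_ereal p))"

text \<open>The space \<open>A\<^sup>p(\<Omega>)\<close>; for \<open>p = \<infinity>\<close> this is \<open>H\<^sup>\<infinity>(\<Omega>)\<close>.\<close>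

definition bergman_space :: "ereal \<Rightarrow> (complex^'n) set \<Rightarrow> (complex^'n \<Rightarrow> complex) set" where
  "bergman_space p \<Omega> = {f \<in> lp_space p \<Omega>. holomorphic_fun_on f \<Omega>}"

definition l2_inner ::
    "(complex^'n) set \<Rightarrow> (complex^'n \<Rightarrow> complex) \<Rightarrow> (complex^'n \<Rightarrow> complex) \<Rightarrow> complex" where
  "l2_inner \<Omega> f g = (LINT z|lebesgue_on \<Omega>. f z * cnj (g z))"

text \<open>
  Orthogonal projection of \<open>L\<^sup>2(\<Omega>)\<close> onto \<open>A\<^sup>2(\<Omega>)\<close>. Vanishing outside \<open>\<Omega>\<close> only serves to make
  the representing total function unique.
\<close>

definition bergman_projection ::
    "(complex^'n) set \<Rightarrow> (complex^'n \<Rightarrow> complex) \<Rightarrow> (complex^'n \<Rightarrow> complex)" where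
  "bergman_projection \<Omega> f =
     (THE h. h \<in> bergman_space 2 \<Omega> \<and> (\<forall>z. z \<notin> \<Omega> \<longrightarrow> h z = 0) \<and>
        (\<forall>g\<in>bergman_space 2 \<Omega>. l2_inner \<Omega> (\<lambda>z. f z - h z) g = 0))"

definition friedrichs ::
    "(complex^'n) set \<Rightarrow> (complex^'n \<Rightarrow> complex) \<Rightarrow> (complex^'n \<Rightarrow> complex)" where
  "friedrichs \<Omega> g = bergman_projection \<Omega> (\<lambda>z. cnj (g z))"

definition bounded_bergman_operator ::
    "(complex^'n) set \<Rightarrow> ereal \<Rightarrow> ereal
       \<Rightarrow> ((complex^'n \<Rightarrow> complex) \<Rightarrow> (complex^'n \<Rightarrow> complex)) \<Rightarrow> bool" where
  "bounded_bergman_operator \<Omega> p q T \<longleftrightarrow>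
     (\<forall>f\<in>bergman_space p \<Omega>. T f \<in> bergman_space q \<Omega>) \<and>
     (\<exists>C. \<forall>f\<in>bergman_space p \<Omega>. lp_norm q \<Omega> (T f) \<le> C * lp_norm p \<Omega> f)"

definition hartogs_triangle :: "(complex^2) set" where
  "hartogs_triangle = {z. norm (z $ 1) < norm (z $ 2) \<and> norm (z $ 2) < 1}"

end

theory Submission
  imports Defs "HOL-Complex_Analysis.Cauchy_Integral_Formula" "HOL-Probability.Probability_Measure"
begin

text \<open>
  The Hartogs triangle \<open>H\<close> is invariant under rotating either coordinate, so an integral over \<open>H\<close>
  does not change when the integrand is averaged over such rotations. For \<open>G\<close> holomorphic on \<open>H\<close>,
  averaging over \<open>z\<^sub>1\<close> replaces \<open>G(z\<^sub>1, z\<^sub>2)\<close> by \<open>G(0, z\<^sub>2)\<close>, a holomorphic function on the punctured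
  unit disc, and averaging over \<open>z\<^sub>2\<close> then leaves only the constant term of its Laurent series
  (\<open>integral_radial_weight_mult_holomorphic\<close>).

  For \<open>f \<in> A\<^sup>2(H)\<close> the restriction \<open>w \<mapsto> f(0, w)\<close> has at most a simple pole: the mean value property
  on small polydiscs around \<open>(0, w)\<close>, whose volume is comparable to \<open>\<bar>w\<bar>\<^sup>4\<close>, shows that a holomorphic
  \<open>L\<^sup>p\<close> function satisfies \<open>\<bar>f(0, w)\<bar> = o(\<bar>w\<bar> powr (-4/p))\<close> (\<open>axis_decay\<close>). Write
  \<open>f(0, w) = (a\<^sub>0 + a\<^sub>1 w + a\<^sub>2 w\<^sup>2 + \<dots>) / w\<close>. The same estimate with \<open>p = 4\<close> shows that \<open>a\<^sub>0 = 0\<close> as soon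
  as \<open>f \<in> A\<^sup>4(H)\<close>.

  With \<open>b\<^sub>k\<close> the coefficients of \<open>g \<in> A\<^sup>2(H)\<close>, the integral of \<open>f g\<close> over \<open>H\<close> is therefore the volume
  \<open>V\<close> of \<open>H\<close> times \<open>a\<^sub>0 b\<^sub>2 + a\<^sub>1 b\<^sub>1 + a\<^sub>2 b\<^sub>0\<close>, whereas \<open>\<langle>g, e\<^sub>k\<rangle> = N\<^sub>k b\<^sub>k\<close> for the three monomials
  \<open>e\<^sub>k = z\<^sub>2\<^sup>k / z\<^sub>2\<close>, \<open>k \<le> 2\<close>, with \<open>N\<^sub>k\<close> the squared norm of \<open>e\<^sub>k\<close>. Comparing the two identities shows
  that the Friedrichs operator has rank three: it maps \<open>f\<close> to the combination of the \<open>e\<^sub>k\<close> with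
  coefficients \<open>V / N\<^sub>k\<close> times the conjugate of \<open>a\<close> at index \<open>2 - k\<close> (\<open>friedrichs_hartogs_eq\<close>).
  Its square thus multiplies each \<open>a\<^sub>k\<close> by a positive constant and discards everything else.

  Each of \<open>a\<^sub>0, a\<^sub>1, a\<^sub>2\<close> is a constant times an integral of \<open>f\<close> against a bounded function (namely
  \<open>z\<^sub>2\<close>, \<open>1\<close> and the conjugate of \<open>z\<^sub>2\<close>), hence is controlled by the \<open>L\<^sup>1\<close> norm of \<open>f\<close>. The functions
  \<open>e\<^sub>1\<close> and \<open>e\<^sub>2\<close> are bounded, and \<open>e\<^sub>0 = 1 / z\<^sub>2\<close> is in \<open>L\<^sup>p\<close> for \<open>p < 4\<close>. This gives the estimates for
  \<open>p < 4\<close> on \<open>A\<^sup>2\<close>, and for all larger \<open>p\<close> on \<open>A\<^sup>4\<close>, where \<open>e\<^sub>0\<close> does not occur. The \<open>A\<^sup>p\<close> bounds follow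
  because \<open>H\<close> has finite volume.
\<close>

section \<open>Invariance of Lebesgue measure under linear isometries\<close>

text \<open>
  By Vitali's theorem an open set is, up to a null set, a disjoint union of balls. The isometry maps
  these to disjoint balls of the same radii, hence of the same measure. Only an inequality results,
  because the image of the null set is not controlled here; applying it to the inverse as well gives
  equality.
\<close>

lemma emeasure_linear_isometry_image_ge:
  fixes U :: "'a::euclidean_space \<Rightarrow> 'a"
  assumes U: "orthogonal_transformation U" and S: "open S"
  shows "emeasure lborel S \<le> emeasure lborel (U ` S)"
proof -
  have lin: "linear U" and inj: "inj U" and nrm: "\<And>x. norm (U x) = norm x"
    using U by (auto simp: orthogonal_transformation_linear orthogonal_transformation_inj
        orthogonal_transformation_norm)
  have surj: "surj U"
    using U by (rule orthogonal_transformation_surj)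
  have ball: "U ` ball a r = ball (U a) r" for a r
    by (rule image_orthogonal_transformation_ball[OF U])
  have opU: "open (U ` X)" if "open X" for X
    using open_surjective_linear_image[OF that lin surj] .
  define K where "K = {(a, r). 0 < r \<and> ball a r \<subseteq> S}"
  obtain C where C: "countable C" "C \<subseteq> K"
     and pw: "pairwise (\<lambda>i j. disjnt (ball (fst i) (snd i)) (ball (fst j) (snd j))) C"
     and neg: "negligible (S - (\<Union>i\<in>C. ball (fst i) (snd i)))"
  proof (rule Vitali_covering_theorem_balls[of S K fst snd])
    fix x and d :: real assume "x \<in> S" "0 < d"
    then obtain e where "e > 0" "ball x e \<subseteq> S" using S open_contains_ball by blast
    then show "\<exists>i. i \<in> K \<and> x \<in> ball (fst i) (snd i) \<and> snd i < d"
      using \<open>0 < d\<close> by (intro exI[of _ "(x, min e (d/2))"]) (auto simp: K_def)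
  qed
  let ?B = "\<lambda>i. ball (fst i) (snd i)"
  have dis: "disjoint_family_on ?B C"
    using pw by (auto simp: disjoint_family_on_def pairwise_def disjnt_def)
  have disU: "disjoint_family_on (\<lambda>i. U ` ?B i) C"
    unfolding disjoint_family_on_def
  proof (intro ballI impI)
    fix i j assume "i \<in> C" "j \<in> C" "i \<noteq> j"
    then have "?B i \<inter> ?B j = {}"
      using dis unfolding disjoint_family_on_def by blast
    then show "U ` ?B i \<inter> U ` ?B j = {}"
      by (metis image_Int[OF inj] image_empty)
  qed
  have sub: "(\<Union>i\<in>C. ?B i) \<subseteq> S" using C by (fastforce simp: K_def)
  have null: "S - (\<Union>i\<in>C. ?B i) \<in> null_sets lborel"
  proof -
    have "S - (\<Union>i\<in>C. ?B i) \<in> sets borel"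
      using S by (intro sets.Diff borel_open open_UN) auto
    then show ?thesis using neg by (simp add: negligible_iff_null_sets null_sets_completion_iff)
  qed
  have "emeasure lborel S = emeasure lborel (\<Union>i\<in>C. ?B i)"
  proof -
    have "open (\<Union>i\<in>C. ?B i)" by auto
    then have "(\<Union>i\<in>C. ?B i) \<in> sets lborel" by simp
    then
    have "emeasure lborel ((\<Union>i\<in>C. ?B i) \<union> (S - (\<Union>i\<in>C. ?B i))) = emeasure lborel (\<Union>i\<in>C. ?B i)"
      by (rule emeasure_Un_null_set[OF _ null])
    then show ?thesis using sub by (simp add: Un_absorb1)
  qed
  also have "\<dots> = (\<integral>\<^sup>+i. emeasure lborel (?B i) \<partial>count_space C)"
    by (rule emeasure_UN_countable) (use C dis in auto)
  also have "\<dots> = (\<integral>\<^sup>+i. emeasure lborel (U ` ?B i) \<partial>count_space C)"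
  proof (rule nn_integral_cong)
    fix i assume "i \<in> space (count_space C)"
    then have "snd i \<ge> 0" using C by (auto simp: K_def)
    then show "emeasure lborel (?B i) = emeasure lborel (U ` ?B i)"
      by (simp add: ball emeasure_ball)
  qed
  also have "\<dots> = emeasure lborel (\<Union>i\<in>C. U ` ?B i)"
    by (rule emeasure_UN_countable[symmetric]) (use C disU opU in auto)
  also have "\<dots> \<le> emeasure lborel (U ` S)"
    by (rule emeasure_mono) (use sub opU S in auto)
  finally show ?thesis .
qed

lemma lborel_distr_orthogonal_transformation:
  fixes U :: "'a::euclidean_space \<Rightarrow> 'a"
  assumes U: "orthogonal_transformation U"
  shows "distr lborel borel U = lborel"
proof (rule lborel_eqI[symmetric])
  have lin: "linear U" and bij: "bij U"
    using U by (auto simp: orthogonal_transformation_linear orthogonal_transformation_bij)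
  have meas[measurable]: "U \<in> borel_measurable borel"
    using lin by (intro borel_measurable_continuous_onI linear_continuous_on) (simp add: linear_conv_bounded_linear)
  fix l u :: 'a assume le: "\<And>b. b \<in> Basis \<Longrightarrow> l \<bullet> b \<le> u \<bullet> b"
  have inv: "orthogonal_transformation (inv U)"
    using U by (rule orthogonal_transformation_inv)
  have pre: "U -` box l u = inv U ` box l u"
    using bij by (simp add: bij_vimage_eq_inv_image)
  have op: "open (inv U ` box l u)"
    by (metis pre continuous_open_vimage lin linear_continuous_at linear_conv_bounded_linear open_box open_vimage linear_continuous_on)
  have "emeasure lborel (box l u) \<le> emeasure lborel (inv U ` box l u)"
    by (rule emeasure_linear_isometry_image_ge[OF inv open_box])
  moreover have "emeasure lborel (inv U ` box l u) \<le> emeasure lborel (U ` inv U ` box l u)"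
    by (rule emeasure_linear_isometry_image_ge[OF U op])
  moreover have "U ` inv U ` box l u = box l u"
    using bij by (metis bij_is_surj image_f_inv_f)
  ultimately have "emeasure lborel (inv U ` box l u) = emeasure lborel (box l u)" by simp
  then show "emeasure (distr lborel borel U) (box l u) = (\<Prod>b\<in>Basis. (u - l) \<bullet> b)"
    using le by (simp add: emeasure_distr pre emeasure_lborel_box_eq)
qed simp

section \<open>Averages over rotations\<close>

text \<open>
  Fubini's theorem on \<open>P \<Otimes>\<^sub>M M\<close>: for every single \<open>t\<close> the function \<open>F \<circ> T t\<close> has the same integral as
  \<open>F\<close>, and \<open>P\<close> has total mass one.
\<close>

lemma integral_average_over_measure_preserving_maps:
  fixes F :: "'a \<Rightarrow> 'c::{banach, second_countable_topology}"
  assumes "sigma_finite_measure M" and "prob_space P"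
    and T[measurable]: "(\<lambda>(t, z). T t z) \<in> measurable (P \<Otimes>\<^sub>M M) M"
    and pres: "\<And>t. t \<in> space P \<Longrightarrow> distr M M (T t) = M"
    and F: "integrable M F"
  shows "integrable M (\<lambda>z. \<integral>t. F (T t z) \<partial>P)"
    and "(\<integral>z. (\<integral>t. F (T t z) \<partial>P) \<partial>M) = integral\<^sup>L M F"
proof -
  interpret P: prob_space P by fact
  interpret M: sigma_finite_measure M by fact
  interpret PM: pair_sigma_finite P M ..
  have [measurable]: "F \<in> borel_measurable M" using F by simp
  have Tt[measurable]: "T t \<in> measurable M M" if "t \<in> space P" for t
    using measurable_compose[OF measurable_Pair1'[OF that] T] by simp
  have int: "integrable M (\<lambda>z. F (T t z))" and eq: "(\<integral>z. F (T t z) \<partial>M) = integral\<^sup>L M F"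
    and eqn: "(\<integral>z. norm (F (T t z)) \<partial>M) = (\<integral>z. norm (F z) \<partial>M)" if "t \<in> space P" for t
  proof -
    show "integrable M (\<lambda>z. F (T t z))"
      by (rule integrable_distr[of "T t" M M]) (use pres[OF that] F Tt[OF that] in auto)
    show "(\<integral>z. F (T t z) \<partial>M) = integral\<^sup>L M F"
      using integral_distr[of "T t" M M F] pres[OF that] Tt[OF that] by simp
    show "(\<integral>z. norm (F (T t z)) \<partial>M) = (\<integral>z. norm (F z) \<partial>M)"
      using integral_distr[of "T t" M M "\<lambda>z. norm (F z)"] pres[OF that] Tt[OF that] by simp
  qed
  have joint: "integrable (P \<Otimes>\<^sub>M M) (\<lambda>(t, z). F (T t z))"
  proof (rule PM.Fubini_integrable)
    have "F \<circ> (\<lambda>(t, z). T t z) \<in> borel_measurable (P \<Otimes>\<^sub>M M)"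
      by (rule measurable_comp[OF T]) simp
    also have "F \<circ> (\<lambda>(t, z). T t z) = (\<lambda>(t, z). F (T t z))" by auto
    finally show "(\<lambda>(t, z). F (T t z)) \<in> borel_measurable (P \<Otimes>\<^sub>M M)" .
    show "integrable P (\<lambda>t. \<integral>z. norm (case (t, z) of (t, z) \<Rightarrow> F (T t z)) \<partial>M)"
      by (subst Bochner_Integration.integrable_cong[OF refl, where g="\<lambda>t. \<integral>z. norm (F z) \<partial>M"])
         (auto simp: eqn)
    show "AE t in P. integrable M (\<lambda>z. case (t, z) of (t, z) \<Rightarrow> F (T t z))"
      by (rule AE_I2) (simp add: int)
  qed
  from PM.integrable_snd[OF joint] show "integrable M (\<lambda>z. \<integral>t. F (T t z) \<partial>P)" by simp
  have "(\<integral>z. (\<integral>t. F (T t z) \<partial>P) \<partial>M) = (\<integral>t. (\<integral>z. F (T t z) \<partial>M) \<partial>P)"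
    by (rule PM.Fubini_integral[OF joint])
  also have "\<dots> = (\<integral>t. integral\<^sup>L M F \<partial>P)"
    by (rule Bochner_Integration.integral_cong) (auto simp: eq)
  also have "\<dots> = integral\<^sup>L M F" by (simp add: P.prob_space)
  finally show "(\<integral>z. (\<integral>t. F (T t z) \<partial>P) \<partial>M) = integral\<^sup>L M F" .
qed

text \<open>
  Cauchy's formula for the \<open>n\<close>-th derivative at the centre of the unit circle, rewritten as a mean over
  the circle: the mean of \<open>\<phi>(\<zeta>) \<zeta>\<^sup>-\<^sup>n\<close> is the \<open>n\<close>-th Taylor coefficient of \<open>\<phi>\<close>.
\<close>

lemma has_integral_circle_mean:
  assumes hol: "\<phi> holomorphic_on ball 0 r" and r: "1 < r"
  shows "((\<lambda>t. \<phi> (exp (2 * of_real pi * \<i> * of_real t)) / exp (2 * of_real pi * \<i> * of_real t) ^ n)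
           has_integral (deriv ^^ n) \<phi> 0 / fact n) {0..1}"
proof -
  have sub: "cball 0 1 \<subseteq> ball (0::complex) r" using r by auto
  have "((\<lambda>u. \<phi> u / (u - 0) ^ Suc n) has_contour_integral 2 * pi * \<i> / fact n * (deriv ^^ n) \<phi> 0)
          (circlepath 0 1)"
    by (rule Cauchy_has_contour_integral_higher_derivative_circlepath)
       (use holomorphic_on_subset[OF hol sub] ball_subset_cball in
         \<open>auto intro: holomorphic_on_imp_continuous_on holomorphic_on_subset\<close>)
  then have "((\<lambda>t. \<phi> (circlepath 0 1 t) / (circlepath 0 1 t) ^ Suc n
        * vector_derivative (circlepath 0 1) (at t within {0..1}))
        has_integral 2 * pi * \<i> / fact n * (deriv ^^ n) \<phi> 0) {0..1}"
    by (simp add: has_contour_integral_def)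
  then have "((\<lambda>t. (2 * pi * \<i>) * (\<phi> (exp (2 * of_real pi * \<i> * of_real t)) / exp (2 * of_real pi * \<i> * of_real t) ^ n))
        has_integral 2 * pi * \<i> / fact n * (deriv ^^ n) \<phi> 0) {0..1}"
    by (rule has_integral_eq[rotated]) (simp add: vector_derivative_circlepath01, simp add: circlepath)
  from has_integral_mult_right[OF this, of "1 / (2 * pi * \<i>)"] show ?thesis by simp
qed

definition rotate_coord :: "2 \<Rightarrow> complex \<Rightarrow> complex^2 \<Rightarrow> complex^2" where
  "rotate_coord k c z = (\<chi> i. if i = k then c * z $ i else z $ i)"

lemma rotate_coord_nth [simp]:
  "rotate_coord k c z $ i = (if i = k then c * z $ i else z $ i)"
  by (simp add: rotate_coord_def)

lemma rotate_coord_rotate_coord [simp]: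
  "rotate_coord k c (rotate_coord k d z) = rotate_coord k (c * d) z"
  by (simp add: vec_eq_iff)

lemma rotate_coord_one [simp]: "rotate_coord k 1 z = z"
  by (simp add: vec_eq_iff)

lemma orthogonal_transformation_rotate_coord:
  assumes "norm c = 1"
  shows "orthogonal_transformation (rotate_coord k c)"
  unfolding orthogonal_transformation
proof (intro conjI allI)
  show "linear (rotate_coord k c)"
    by (intro linearI) (simp_all add: vec_eq_iff algebra_simps)
  show "norm (rotate_coord k c v) = norm v" for v
    unfolding norm_vec_def using assms
    by (intro arg_cong2[where f=L2_set] refl ext) (simp add: norm_mult)
qed

lemma continuous_rotate_coord:
  "continuous_on UNIV (\<lambda>(c, z). rotate_coord k c z)"
  unfolding rotate_coord_def case_prod_unfold
proof (rule continuous_on_vec_lambda)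
  fix i
  show "continuous_on UNIV (\<lambda>x. if i = k then fst x * snd x $ i else snd x $ i :: complex)"
    by (cases "i = k") (auto intro!: continuous_intros)
qed

definition rotation_invariant :: "2 \<Rightarrow> (complex^2) set \<Rightarrow> bool" where
  "rotation_invariant k S \<longleftrightarrow> (\<forall>c z. norm c = 1 \<longrightarrow> z \<in> S \<longrightarrow> rotate_coord k c z \<in> S)"

lemma distr_rotate_coord:
  assumes S: "S \<in> sets borel" "rotation_invariant k S" and c: "norm c = 1"
  shows "distr (restrict_space lborel S) (restrict_space lborel S) (rotate_coord k c)
           = restrict_space lborel S"
proof -
  let ?M = "restrict_space lborel S"
  have [measurable]: "rotate_coord k c \<in> borel_measurable borel"
    using orthogonal_transformation_linear[OF orthogonal_transformation_rotate_coord[OF c]]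
    by (intro borel_measurable_continuous_onI linear_continuous_on)
       (simp add: linear_conv_bounded_linear)
  have m: "rotate_coord k c \<in> measurable ?M ?M"
    using S c by (intro measurable_restrict_space2 measurable_restrict_space1)
      (auto simp: rotation_invariant_def space_restrict_space)
  show ?thesis
  proof (rule measure_eqI)
    fix A assume "A \<in> sets (distr ?M ?M (rotate_coord k c))"
    then have A: "A \<in> sets ?M" by simp
    then have AS: "A \<subseteq> S" "A \<in> sets borel"
      using S by (auto simp: sets_restrict_space_iff)
    have "z \<in> S" if "rotate_coord k c z \<in> A" for z
    proof -
      have "rotate_coord k (inverse c) (rotate_coord k c z) \<in> S"
        using S c that AS unfolding rotation_invariant_def
        by (metis norm_inverse inverse_1 subsetD)
      moreover have "inverse c * c = 1" using c by (metis left_inverse norm_zero zero_neq_one)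
      ultimately show ?thesis by simp
    qed
    then have eq: "rotate_coord k c -` A \<inter> space ?M = rotate_coord k c -` A"
      by (auto simp: space_restrict_space)
    have "emeasure (distr ?M ?M (rotate_coord k c)) A = emeasure ?M (rotate_coord k c -` A)"
      using emeasure_distr[OF m A] eq by simp
    also have "\<dots> = emeasure lborel (rotate_coord k c -` A)"
      using eq S by (intro emeasure_restrict_space) (auto simp: space_restrict_space)
    also have "\<dots> = emeasure (distr lborel borel (rotate_coord k c)) A"
      using AS by (simp add: emeasure_distr)
    also have "\<dots> = emeasure lborel A"
      by (simp add: lborel_distr_orthogonal_transformation orthogonal_transformation_rotate_coord c)
    also have "\<dots> = emeasure ?M A"
      using S AS by (intro emeasure_restrict_space[symmetric]) auto
    finally show "emeasure (distr ?M ?M (rotate_coord k c)) A = emeasure ?M A" .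
  qed simp
qed

lemma sigma_finite_restrict_lborel:
  "S \<in> sets borel \<Longrightarrow> sigma_finite_measure (restrict_space lborel S)"
  by (intro sigma_finite_measure_restrict_space lborel.sigma_finite_measure_axioms) auto

text \<open>
  Rotating coordinate \<open>k\<close> about the full circle replaces \<open>F\<close> by its circle means. These are
  computable when \<open>F\<close>, as a function of the rotating factor \<open>\<zeta>\<close>, is meromorphic with at most
  a pole of order \<open>n\<close> at the origin.
\<close>

lemma rotation_mean:
  fixes F :: "complex^2 \<Rightarrow> complex"
  assumes S: "S \<in> sets borel" "rotation_invariant k S"
    and F: "integrable (restrict_space lborel S) F"
    and mean: "\<And>z. z \<in> S \<Longrightarrow> \<exists>\<phi> r. 1 < r \<and> \<phi> holomorphic_on ball 0 r \<and>
        (\<forall>\<zeta>. norm \<zeta> = 1 \<longrightarrow> F (rotate_coord k \<zeta> z) = \<phi> \<zeta> / \<zeta> ^ n) \<and>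
        (deriv ^^ n) \<phi> 0 / fact n = G z"
  shows "integrable (restrict_space lborel S) G"
    and "(LINT z|restrict_space lborel S. G z) = (LINT z|restrict_space lborel S. F z)"
proof -
  let ?M = "restrict_space lborel S"
  define P where "P = restrict_space lborel {0..1::real}"
  define e where "e = (\<lambda>t::real. exp (2 * of_real pi * \<i> * of_real t))"
  have ne: "norm (e t) = 1" for t by (simp add: e_def norm_exp_eq_Re)
  have ce: "continuous_on X e" for X unfolding e_def by (intro continuous_intros)
  have "prob_space P"
    by (rule prob_spaceI) (simp add: P_def space_restrict_space emeasure_restrict_space)
  have T: "(\<lambda>(t, z). rotate_coord k (e t) z) \<in> measurable (P \<Otimes>\<^sub>M ?M) ?M"
  proof (rule measurable_restrict_space2)
    show "(\<lambda>(t, z). rotate_coord k (e t) z) \<in> space (P \<Otimes>\<^sub>M ?M) \<rightarrow> S"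
      using S ne by (auto simp: space_pair_measure rotation_invariant_def space_restrict_space)
    have "continuous_on UNIV ((\<lambda>(c, z). rotate_coord k c z) \<circ> (\<lambda>x. (e (fst x), snd x)))"
      by (intro continuous_on_compose continuous_on_subset[OF continuous_rotate_coord]
          continuous_on_Pair continuous_on_compose2[OF ce] continuous_intros) auto
    then have m: "(\<lambda>(t, z). rotate_coord k (e t) z) \<in> borel_measurable borel"
      by (intro borel_measurable_continuous_onI) (simp add: o_def case_prod_unfold)
    have "(\<lambda>x. x) \<in> measurable (P \<Otimes>\<^sub>M ?M) (lborel \<Otimes>\<^sub>M lborel)"
      unfolding P_def
      by (intro measurable_pair) (auto simp: o_def
          intro!: measurable_compose[OF measurable_fst] measurable_compose[OF measurable_snd]
            measurable_restrict_space1)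
    from measurable_compose[OF this, of "\<lambda>(t, z). rotate_coord k (e t) z" lborel] m
    show "(\<lambda>(t, z). rotate_coord k (e t) z) \<in> measurable (P \<Otimes>\<^sub>M ?M) lborel"
      by (simp add: lborel_prod)
  qed
  have avg: "(\<integral>t. F (rotate_coord k (e t) z) \<partial>P) = G z" if "z \<in> space ?M" for z
  proof -
    from that have "z \<in> S" by (simp add: space_restrict_space)
    from mean[OF this] obtain \<phi> r where r: "1 < r" and hol: "\<phi> holomorphic_on ball 0 r"
      and eq: "\<And>\<zeta>. norm \<zeta> = 1 \<Longrightarrow> F (rotate_coord k \<zeta> z) = \<phi> \<zeta> / \<zeta> ^ n"
      and G: "(deriv ^^ n) \<phi> 0 / fact n = G z" by blast
    let ?g = "\<lambda>t. \<phi> (e t) / e t ^ n"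
    have "continuous_on {0..1} ?g"
      by (intro continuous_intros continuous_on_compose2[OF holomorphic_on_imp_continuous_on[OF hol]] ce)
         (use ne r in \<open>auto simp: e_def\<close>)
    then have int: "set_integrable lborel {0..1} ?g"
      unfolding set_integrable_def by (intro borel_integrable_compact) auto
    have "(\<integral>t. F (rotate_coord k (e t) z) \<partial>P) = (\<integral>t. ?g t \<partial>P)"
      by (simp add: eq ne)
    also have "\<dots> = set_lebesgue_integral lborel {0..1} ?g"
      by (simp add: P_def integral_restrict_space set_lebesgue_integral_def)
    also have "\<dots> = integral {0..1} ?g"
      by (rule set_borel_integral_eq_integral(2)[OF int])
    also have "\<dots> = G z"
      using has_integral_circle_mean[OF hol r, of n] G unfolding e_def
      by (simp add: integral_unique)
    finally show ?thesis .
  qed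
  note avgs = integral_average_over_measure_preserving_maps[OF
      sigma_finite_restrict_lborel[OF S(1)] \<open>prob_space P\<close> T _ F]
  have pres: "distr ?M ?M (rotate_coord k (e t)) = ?M" for t
    by (rule distr_rotate_coord[OF S ne])
  show "integrable ?M G"
    using avgs(1)[OF pres] by (subst (asm) Bochner_Integration.integrable_cong[OF refl avg]) auto
  show "(LINT z|?M. G z) = (LINT z|?M. F z)"
    using avgs(2)[OF pres] by (subst (asm) Bochner_Integration.integral_cong[OF refl avg]) auto
qed

section \<open>Lebesgue integrals of Borel measurable functions\<close>

lemma
  fixes f :: "'a::euclidean_space \<Rightarrow> 'b::{banach, second_countable_topology}"
  assumes S: "S \<in> sets borel" and f: "f \<in> borel_measurable (restrict_space lborel S)"
  shows integrable_lebesgue_on_iff_lborel: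
      "integrable (lebesgue_on S) f \<longleftrightarrow> integrable (restrict_space lborel S) f"
    and integral_lebesgue_on_eq_lborel:
      "integral\<^sup>L (lebesgue_on S) f = integral\<^sup>L (restrict_space lborel S) f"
proof -
  have S': "S \<inter> space lebesgue \<in> sets lebesgue" "S \<inter> space lborel \<in> sets lborel" using S by auto
  have m: "(\<lambda>x. indicator S x *\<^sub>R f x) \<in> borel_measurable lborel"
    using iffD1[OF borel_measurable_restrict_space_iff[OF S'(2)] f] by simp
  show "integrable (lebesgue_on S) f \<longleftrightarrow> integrable (restrict_space lborel S) f"
    unfolding integrable_restrict_space[OF S'(1)] integrable_restrict_space[OF S'(2)]
    by (rule integrable_completion[OF m])
  show "integral\<^sup>L (lebesgue_on S) f = integral\<^sup>L (restrict_space lborel S) f"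
    unfolding integral_restrict_space[OF S'(1)] integral_restrict_space[OF S'(2)]
    by (rule integral_completion[OF m])
qed

lemma borel_measurable_restrict_lborel_continuous:
  fixes f :: "'a::euclidean_space \<Rightarrow> 'b::topological_space"
  assumes "continuous_on S f"
  shows "f \<in> borel_measurable (restrict_space lborel S)"
  using borel_measurable_continuous_on_restrict[OF assms]
  by (subst measurable_cong_sets[of _ "restrict_space borel S"]) (auto simp: sets_restrict_space)

section \<open>Holomorphic functions of several variables\<close>

lemma holomorphic_fun_on_imp_continuous_on:
  "holomorphic_fun_on f \<Omega> \<Longrightarrow> continuous_on \<Omega> f"
  unfolding holomorphic_fun_on_def
  by (meson continuous_at_imp_continuous_on has_derivative_continuous)

lemma holomorphic_fun_on_cong:
  assumes "open \<Omega>" and "\<And>z. z \<in> \<Omega> \<Longrightarrow> f z = g z" and "holomorphic_fun_on f \<Omega>"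
  shows "holomorphic_fun_on g \<Omega>"
  using assms unfolding holomorphic_fun_on_def
  by (meson has_derivative_transform_within_open)

lemma holomorphic_fun_on_mult:
  assumes "holomorphic_fun_on f \<Omega>" "holomorphic_fun_on g \<Omega>"
  shows "holomorphic_fun_on (\<lambda>z. f z * g z) \<Omega>"
  unfolding holomorphic_fun_on_def
proof
  fix z assume "z \<in> \<Omega>"
  with assms obtain D E where "(f has_derivative D) (at z)" "\<forall>c v. D (c *s v) = c * D v"
    "(g has_derivative E) (at z)" "\<forall>c v. E (c *s v) = c * E v"
    unfolding holomorphic_fun_on_def by meson
  then show "\<exists>D. ((\<lambda>z. f z * g z) has_derivative D) (at z) \<and> (\<forall>c v. D (c *s v) = c * D v)"
    by (intro exI[of _ "\<lambda>v. f z * E v + D v * g z"])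
       (auto intro!: derivative_eq_intros simp: algebra_simps)
qed

lemma holomorphic_fun_on_diff:
  assumes "holomorphic_fun_on f \<Omega>" "holomorphic_fun_on g \<Omega>"
  shows "holomorphic_fun_on (\<lambda>z. f z - g z) \<Omega>"
  unfolding holomorphic_fun_on_def
proof
  fix z assume "z \<in> \<Omega>"
  with assms obtain D E where "(f has_derivative D) (at z)" "\<forall>c v. D (c *s v) = c * D v"
    "(g has_derivative E) (at z)" "\<forall>c v. E (c *s v) = c * E v"
    unfolding holomorphic_fun_on_def by meson
  then show "\<exists>D. ((\<lambda>z. f z - g z) has_derivative D) (at z) \<and> (\<forall>c v. D (c *s v) = c * D v)"
    by (intro exI[of _ "\<lambda>v. D v - E v"])
       (auto intro!: derivative_eq_intros simp: algebra_simps)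
qed

lemma holomorphic_fun_on_coordinate:
  fixes h :: "complex \<Rightarrow> complex"
  assumes h: "h holomorphic_on A" and A: "open A" and sub: "\<And>z. z \<in> \<Omega> \<Longrightarrow> z $ k \<in> A"
  shows "holomorphic_fun_on (\<lambda>z. h (z $ k)) \<Omega>"
  unfolding holomorphic_fun_on_def
proof
  fix z assume "z \<in> \<Omega>"
  then have "(h has_field_derivative deriv h (z $ k)) (at (z $ k))"
    using holomorphic_derivI[OF h A] sub by blast
  then have d: "(h has_derivative (\<lambda>v. deriv h (z $ k) * v)) (at (z $ k))"
    by (simp add: has_field_derivative_def)
  have n: "((\<lambda>z. z $ k) has_derivative (\<lambda>v. v $ k)) (at z)"
    by (rule bounded_linear_imp_has_derivative[OF bounded_linear_vec_nth])
  have "((\<lambda>z. h (z $ k)) has_derivative (\<lambda>v. deriv h (z $ k) * v $ k)) (at z)"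
    using diff_chain_at[OF n d] by (simp add: o_def)
  then show "\<exists>D. ((\<lambda>z. h (z $ k)) has_derivative D) (at z) \<and> (\<forall>c v. D (c *s v) = c * D v)"
    by (intro exI[of _ "\<lambda>v. deriv h (z $ k) * v $ k"]) auto
qed

text \<open>
  Complex linearity of the Frechet derivative is what turns the chain rule into complex
  differentiability in the parameter of the line.
\<close>

lemma holomorphic_on_affine_line:
  fixes f :: "complex^'n \<Rightarrow> complex"
  assumes f: "holomorphic_fun_on f \<Omega>" and sub: "\<And>\<zeta>. \<zeta> \<in> U \<Longrightarrow> a + \<zeta> *s v \<in> \<Omega>"
  shows "(\<lambda>\<zeta>. f (a + \<zeta> *s v)) holomorphic_on U"
proof (rule holomorphic_onI)
  fix \<zeta> assume "\<zeta> \<in> U"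
  then obtain D where D: "(f has_derivative D) (at (a + \<zeta> *s v))" "\<And>c v. D (c *s v) = c * D v"
    using f sub unfolding holomorphic_fun_on_def by meson
  have "bounded_linear (\<lambda>h. h *s v)"
    unfolding linear_conv_bounded_linear[symmetric]
    by (intro linearI) (simp_all add: vec_eq_iff algebra_simps)
  then have "((\<lambda>\<zeta>. a + \<zeta> *s v) has_derivative (\<lambda>h. h *s v)) (at \<zeta>)"
    by (auto intro!: derivative_eq_intros bounded_linear_imp_has_derivative)
  from diff_chain_at[OF this D(1)]
  have "((\<lambda>\<zeta>. f (a + \<zeta> *s v)) has_derivative (\<lambda>h. D v * h)) (at \<zeta>)"
    by (simp add: o_def D(2) mult.commute)
  then have "((\<lambda>\<zeta>. f (a + \<zeta> *s v)) has_field_derivative D v) (at \<zeta>)"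
    by (simp add: has_field_derivative_def)
  then show "(\<lambda>\<zeta>. f (a + \<zeta> *s v)) field_differentiable at \<zeta> within U"
    using field_differentiable_at_within field_differentiable_def by blast
qed

section \<open>Integrals of holomorphic functions over the Hartogs triangle\<close>

lemma axis_2_nth [simp]: "(axis 2 w :: complex^2) $ 1 = 0" "(axis 1 w :: complex^2) $ 2 = 0"
  by (simp_all add: axis_def)

lemma open_hartogs_triangle: "open hartogs_triangle"
  unfolding hartogs_triangle_def
  by (intro open_Collect_conj open_Collect_less continuous_intros)

lemma hartogs_triangle_borel [measurable]: "hartogs_triangle \<in> sets borel"
  using open_hartogs_triangle by simp

abbreviation hartogs_measure :: "(complex^2) measure" where
  "hartogs_measure \<equiv> restrict_space lborel hartogs_triangle"

lemma space_hartogs_measure [simp]: "space hartogs_measure = hartogs_triangle"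
  by (simp add: space_restrict_space)

lemma rotation_invariant_hartogs: "rotation_invariant k hartogs_triangle"
  by (auto simp: rotation_invariant_def hartogs_triangle_def norm_mult)

lemma bounded_hartogs_triangle: "bounded hartogs_triangle"
proof (rule boundedI)
  fix z :: "complex^2" assume "z \<in> hartogs_triangle"
  then have "norm (z $ 1) \<le> 1" "norm (z $ 2) \<le> 1" by (auto simp: hartogs_triangle_def)
  then show "norm z \<le> 2"
    using norm_le_l1_cart[of "\<chi> i. norm (z $ i)"] by (simp add: norm_vec_def sum_2 L2_set_def)
qed

lemma emeasure_hartogs_finite: "emeasure lborel hartogs_triangle < \<infinity>"
  by (rule emeasure_bounded_finite[OF bounded_hartogs_triangle])

lemma finite_measure_hartogs: "finite_measure hartogs_measure"
  by (rule finite_measureI)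
     (use emeasure_hartogs_finite in \<open>auto simp: emeasure_restrict_space\<close>)

lemma axis_2_in_hartogs_iff [simp]: "axis 2 w \<in> hartogs_triangle \<longleftrightarrow> 0 < norm w \<and> norm w < 1"
  by (simp add: hartogs_triangle_def)

lemma emeasure_hartogs_pos: "emeasure lborel hartogs_triangle > 0"
proof -
  have "axis 2 (1/2) \<in> hartogs_triangle" by simp
  then have "hartogs_triangle \<noteq> {}" by blast
  then have "hartogs_triangle \<notin> null_sets lborel"
    using open_not_negligible[OF open_hartogs_triangle]
    by (auto simp: negligible_iff_null_sets null_sets_completionI)
  then show ?thesis by (simp add: null_sets_def zero_less_iff_neq_zero)
qed

text \<open>
  Averaging over the rotations of the first coordinate replaces \<open>G z\<close> by its value at the centre of
  the disc \<open>\<bar>z\<^sub>1\<bar> < \<bar>z\<^sub>2\<bar>\<close>, a point of the axis. Averaging over the rotations of the second coordinate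
  extracts the constant Laurent coefficient of \<open>\<Phi> u / u\<^sup>2\<close>, the second Taylor coefficient of \<open>\<Phi>\<close>.
  The weight is constant along both averages.
\<close>

lemma integral_radial_weight_mult_holomorphic:
  fixes w :: "real \<Rightarrow> real"
  assumes G: "holomorphic_fun_on G hartogs_triangle"
    and \<Phi>: "\<Phi> holomorphic_on ball 0 1"
    and eq: "\<And>u. 0 < norm u \<Longrightarrow> norm u < 1 \<Longrightarrow> G (axis 2 u) = \<Phi> u / u ^ 2"
    and int: "integrable hartogs_measure (\<lambda>z. of_real (w (norm (z $ 2))) * G z)"
  shows "(LINT z|hartogs_measure. of_real (w (norm (z $ 2))) * G z)
       = (deriv ^^ 2) \<Phi> 0 / 2 * of_real (LINT z|hartogs_measure. w (norm (z $ 2)))"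
proof -
  let ?W = "\<lambda>z::complex^2. complex_of_real (w (norm (z $ 2)))"
  have rot1: "rotate_coord 1 \<zeta> z = axis 2 (z $ 2) + \<zeta> *s axis 1 (z $ 1)" for \<zeta> and z :: "complex^2"
    by (simp add: vec_eq_iff forall_2)
  have mean1: "\<exists>\<phi> r. 1 < r \<and> \<phi> holomorphic_on ball 0 r \<and>
        (\<forall>\<zeta>. norm \<zeta> = 1 \<longrightarrow> ?W (rotate_coord 1 \<zeta> z) * G (rotate_coord 1 \<zeta> z) = \<phi> \<zeta> / \<zeta> ^ 0) \<and>
        (deriv ^^ 0) \<phi> 0 / fact 0 = ?W z * G (axis 2 (z $ 2))" if z: "z \<in> hartogs_triangle" for z
  proof -
    let ?\<phi> = "\<lambda>\<zeta>. ?W z * G (axis 2 (z $ 2) + \<zeta> *s axis 1 (z $ 1))"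
    define r where "r = (if z $ 1 = 0 then 2 else norm (z $ 2) / norm (z $ 1))"
    have r: "1 < r" using z by (auto simp: r_def hartogs_triangle_def)
    have "?\<phi> holomorphic_on ball 0 r"
    proof (intro holomorphic_intros holomorphic_on_affine_line[OF G])
      fix \<zeta> :: complex assume "\<zeta> \<in> ball 0 r"
      then have "norm (\<zeta> * z $ 1) < norm (z $ 2)"
        using z by (auto simp: r_def norm_mult hartogs_triangle_def field_simps split: if_splits)
      then show "axis 2 (z $ 2) + \<zeta> *s axis 1 (z $ 1) \<in> hartogs_triangle"
        using z by (simp add: hartogs_triangle_def)
    qed
    then show ?thesis using r
      by (intro exI[of _ ?\<phi>] exI[of _ r]) (simp add: rot1)
  qed
  note m1 = rotation_mean[OF hartogs_triangle_borel rotation_invariant_hartogs int mean1]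
  have mean2: "\<exists>\<phi> r. 1 < r \<and> \<phi> holomorphic_on ball 0 r \<and>
        (\<forall>\<zeta>. norm \<zeta> = 1 \<longrightarrow> ?W (rotate_coord 2 \<zeta> z) * G (axis 2 (rotate_coord 2 \<zeta> z $ 2)) = \<phi> \<zeta> / \<zeta> ^ 2) \<and>
        (deriv ^^ 2) \<phi> 0 / fact 2 = ?W z * ((deriv ^^ 2) \<Phi> 0 / 2)" if z: "z \<in> hartogs_triangle" for z
  proof -
    define r where "r = 1 / norm (z $ 2)"
    have z2: "0 < norm (z $ 2)" "norm (z $ 2) < 1"
      using z by (auto simp: hartogs_triangle_def intro: le_less_trans[OF norm_ge_zero])
    have r: "1 < r" using z2 by (auto simp: r_def field_simps)
    let ?c = "?W z / (z $ 2) ^ 2"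
    let ?\<phi> = "\<lambda>\<zeta>. ?c * \<Phi> (z $ 2 * \<zeta>)"
    have sub: "z $ 2 * \<zeta> \<in> ball 0 1" if "\<zeta> \<in> ball 0 r" for \<zeta>
      using that z2 by (simp add: r_def norm_mult field_simps)
    have img: "(*) (z $ 2) ` ball 0 r \<subseteq> ball 0 1" by (intro image_subsetI sub)
    have hol: "(\<lambda>\<zeta>. \<Phi> (z $ 2 * \<zeta>)) holomorphic_on ball 0 r"
      using holomorphic_on_compose_gen[OF _ \<Phi> img]
      by (simp add: o_def holomorphic_on_ident holomorphic_on_mult)
    have "(deriv ^^ 2) ?\<phi> 0 = ?c * (deriv ^^ 2) (\<lambda>\<zeta>. \<Phi> (z $ 2 * \<zeta>)) 0"
      by (rule higher_deriv_cmult[OF hol]) (use r in auto)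
    also have "\<dots> = ?c * ((z $ 2) ^ 2 * (deriv ^^ 2) \<Phi> (z $ 2 * 0))"
      by (subst higher_deriv_compose_linear[OF \<Phi>, of "ball 0 r"]) (use r sub in auto)
    also have "\<dots> = ?W z * (deriv ^^ 2) \<Phi> 0" using z2 by auto
    finally have d: "(deriv ^^ 2) ?\<phi> 0 / fact 2 = ?W z * ((deriv ^^ 2) \<Phi> 0 / 2)" by simp
    have "?W (rotate_coord 2 \<zeta> z) * G (axis 2 (rotate_coord 2 \<zeta> z $ 2)) = ?\<phi> \<zeta> / \<zeta> ^ 2" if "norm \<zeta> = 1" for \<zeta>
    proof -
      have "0 < norm (\<zeta> * z $ 2)" "norm (\<zeta> * z $ 2) < 1" using that z2 by (auto simp: norm_mult)
      from eq[OF this] show ?thesis using that z2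
        by (simp add: norm_mult power_mult_distrib field_simps)
    qed
    moreover have "?\<phi> holomorphic_on ball 0 r" using hol by (intro holomorphic_intros)
    ultimately show ?thesis using r d by (intro exI[of _ ?\<phi>] exI[of _ r]) blast
  qed
  have "(LINT z|hartogs_measure. ?W z * G z) = (LINT z|hartogs_measure. ?W z * G (axis 2 (z $ 2)))"
    by (rule m1(2)[symmetric])
  also have "\<dots> = (LINT z|hartogs_measure. ?W z * ((deriv ^^ 2) \<Phi> 0 / 2))"
    by (rule rotation_mean(2)[OF hartogs_triangle_borel rotation_invariant_hartogs m1(1) mean2, symmetric])
  also have "\<dots> = (deriv ^^ 2) \<Phi> 0 / 2 * of_real (LINT z|hartogs_measure. w (norm (z $ 2)))"
    by (simp add: mult.commute)
  finally show ?thesis .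
qed

section \<open>Growth of holomorphic functions along the axis\<close>

definition polydisc :: "real \<Rightarrow> (complex^2) set" where
  "polydisc d = {u. norm (u $ 1) < d \<and> norm (u $ 2) < d}"

lemma open_polydisc: "open (polydisc d)"
  unfolding polydisc_def by (intro open_Collect_conj open_Collect_less continuous_intros)

lemma polydisc_borel [measurable]: "polydisc d \<in> sets borel"
  using open_polydisc by simp

lemma bounded_polydisc: "bounded (polydisc d)"
proof (rule boundedI)
  fix z :: "complex^2" assume "z \<in> polydisc d"
  then have "norm (z $ 1) \<le> d" "norm (z $ 2) \<le> d" by (auto simp: polydisc_def)
  then show "norm z \<le> 2 * d"
    using norm_le_l1_cart[of "\<chi> i. norm (z $ i)"] by (simp add: norm_vec_def sum_2 L2_set_def)
qed

lemma rotation_invariant_polydisc: "rotation_invariant k (polydisc d)"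
  by (auto simp: rotation_invariant_def polydisc_def norm_mult)

lemma measure_polydisc_pos:
  assumes "0 < d" shows "0 < measure lborel (polydisc d)"
proof -
  have "0 \<in> polydisc d" using assms by (simp add: polydisc_def)
  then have "polydisc d \<noteq> {}" by blast
  then have "polydisc d \<notin> null_sets lebesgue"
    using open_not_negligible[OF open_polydisc] by (simp add: negligible_iff_null_sets)
  then have "polydisc d \<notin> null_sets lborel"
    by (auto dest: null_sets_completionI)
  moreover have "emeasure lborel (polydisc d) < \<infinity>"
    by (rule emeasure_bounded_finite[OF bounded_polydisc])
  ultimately show ?thesis
    by (simp add: null_sets_def measure_def enn2real_positive_iff zero_less_iff_neq_zero)
qed

lemma measure_polydisc:
  assumes "0 < d" shows "measure lborel (polydisc d) = d ^ 4 * measure lborel (polydisc 1)"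
proof -
  have "polydisc d = (\<lambda>x. d *\<^sub>R x + 0) ` polydisc 1"
  proof (intro equalityI subsetI)
    fix u :: "complex^2" assume "u \<in> polydisc d"
    then show "u \<in> (\<lambda>x. d *\<^sub>R x + 0) ` polydisc 1"
      using assms by (intro image_eqI[of _ _ "(1/d) *\<^sub>R u"]) (auto simp: polydisc_def field_simps)
  qed (use assms in \<open>auto simp: polydisc_def\<close>)
  then have "measure lebesgue (polydisc d) = \<bar>d\<bar> ^ DIM(complex^2) * measure lebesgue (polydisc 1)"
    using measure_lebesgue_affine[of d 0 "polydisc 1"] by simp
  then show ?thesis using assms by (simp add: measure_completion)
qed

text \<open>
  Polydiscs are rotation invariant too, so the value at the centre is the mean over the polydisc.
\<close>

lemma norm_le_polydisc_mean:
  assumes f: "holomorphic_fun_on f \<Omega>" and sub: "\<And>u. u \<in> polydisc d \<Longrightarrow> a + u \<in> \<Omega>"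
    and int: "integrable (restrict_space lborel (polydisc d)) (\<lambda>u. f (a + u))"
  shows "norm (f a) * measure lborel (polydisc d)
       \<le> (LINT u|restrict_space lborel (polydisc d). norm (f (a + u)))"
proof -
  let ?M = "restrict_space lborel (polydisc d)"
  have mean: "\<exists>\<phi> r. 1 < r \<and> \<phi> holomorphic_on ball 0 r \<and>
        (\<forall>\<zeta>. norm \<zeta> = 1 \<longrightarrow> f (a + p (rotate_coord k \<zeta> u)) = \<phi> \<zeta> / \<zeta> ^ 0) \<and>
        (deriv ^^ 0) \<phi> 0 / fact 0 = f (a + v)"
    if u: "u \<in> polydisc d" "v \<in> polydisc d"
      and p: "\<And>\<zeta>. p (rotate_coord k \<zeta> u) = v + \<zeta> *s axis k (u $ k)" and v: "v $ k = 0"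
    for k p v u
  proof -
    define r where "r = (if u $ k = 0 then 2 else d / norm (u $ k))"
    have uk: "norm (u $ k) < d" using u(1) exhaust_2[of k] by (auto simp: polydisc_def)
    have r: "1 < r" using uk by (auto simp: r_def)
    have mem: "v + \<zeta> *s axis k (u $ k) \<in> polydisc d" if "\<zeta> \<in> ball 0 r" for \<zeta>
    proof -
      have "norm (\<zeta> * u $ k) < d"
        using that uk by (auto simp: r_def norm_mult field_simps split: if_splits)
      then show ?thesis using u(2) v exhaust_2[of k] by (auto simp: polydisc_def)
    qed
    have "(\<lambda>\<zeta>. f ((a + v) + \<zeta> *s axis k (u $ k))) holomorphic_on ball 0 r"
      by (rule holomorphic_on_affine_line[OF f]) (use sub mem in \<open>simp add: add.assoc\<close>)
    then show ?thesis using r p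
      by (intro exI[of _ "\<lambda>\<zeta>. f (a + v + \<zeta> *s axis k (u $ k))"] exI[of _ r]) (simp add: add.assoc)
  qed
  have z0: "0 \<in> polydisc d" if "u \<in> polydisc d" for u
    using that le_less_trans[OF norm_ge_zero[of "u $ 1"]] by (auto simp: polydisc_def)
  have mean1: "\<exists>\<phi> r. 1 < r \<and> \<phi> holomorphic_on ball 0 r \<and>
        (\<forall>\<zeta>. norm \<zeta> = 1 \<longrightarrow> f (a + rotate_coord 1 \<zeta> u) = \<phi> \<zeta> / \<zeta> ^ 0) \<and>
        (deriv ^^ 0) \<phi> 0 / fact 0 = f (a + axis 2 (u $ 2))" if "u \<in> polydisc d" for u
    using mean[of u "axis 2 (u $ 2)" "\<lambda>x. x" 1] that z0[OF that]
    by (simp add: vec_eq_iff forall_2 polydisc_def)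
  have mean2: "\<exists>\<phi> r. 1 < r \<and> \<phi> holomorphic_on ball 0 r \<and>
        (\<forall>\<zeta>. norm \<zeta> = 1 \<longrightarrow> f (a + axis 2 (rotate_coord 2 \<zeta> u $ 2)) = \<phi> \<zeta> / \<zeta> ^ 0) \<and>
        (deriv ^^ 0) \<phi> 0 / fact 0 = f (a + 0)" if "u \<in> polydisc d" for u
    using mean[of u 0 "\<lambda>x. axis 2 (x $ 2)" 2] that z0[OF that]
    by (simp add: vec_eq_iff forall_2)
  note m1 = rotation_mean[OF polydisc_borel rotation_invariant_polydisc int mean1]
  have "(LINT u|?M. f (a + u)) = (LINT u|?M. f (a + axis 2 (u $ 2)))"
    by (rule m1(2)[symmetric])
  also have "\<dots> = (LINT u|?M. f (a + 0))"
    by (rule rotation_mean(2)[OF polydisc_borel rotation_invariant_polydisc m1(1) mean2, symmetric])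
  also have "\<dots> = f a * of_real (measure lborel (polydisc d))"
    by (simp add: measure_restrict_space space_restrict_space scaleR_conv_of_real mult.commute)
  finally have "f a * of_real (measure lborel (polydisc d)) = (LINT u|?M. f (a + u))" by simp
  then have "norm (f a) * measure lborel (polydisc d) = norm (LINT u|?M. f (a + u))"
    by (metis abs_of_nonneg measure_nonneg norm_mult norm_of_real)
  also have "\<dots> \<le> (LINT u|?M. norm (f (a + u)))" by (rule integral_norm_bound)
  finally show ?thesis .
qed

lemma integral_near_axis_small:
  fixes g :: "complex^2 \<Rightarrow> real"
  assumes g: "integrable hartogs_measure g" and e: "0 < e"
  obtains r where "0 < r"
    "(LINT z|hartogs_measure. indicator {z. norm (z $ 2) < r} z * g z) < e"
proof -
  let ?s = "\<lambda>n z. indicator {z. norm (z $ 2) < 1 / real (Suc n)} z * g z"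
  have [measurable]: "g \<in> borel_measurable hartogs_measure" using g by simp
  have op: "{z::complex^2. norm (z $ 2) < c} \<in> sets borel" for c
    by (intro borel_open open_Collect_less continuous_intros)
  have m: "?s n \<in> borel_measurable hartogs_measure" for n
  proof -
    have "(indicator {z. norm (z $ 2) < 1 / real (Suc n)} :: complex^2 \<Rightarrow> real) \<in> borel_measurable lborel"
      using op by simp
    then have "(indicator {z. norm (z $ 2) < 1 / real (Suc n)} :: complex^2 \<Rightarrow> real) \<in> borel_measurable hartogs_measure"
      by (rule measurable_restrict_space1)
    then show ?thesis by measurable
  qed
  have "(\<lambda>n. LINT z|hartogs_measure. ?s n z) \<longlonglongrightarrow> (LINT z|hartogs_measure. 0)"
  proof (rule integral_dominated_convergence[where w="\<lambda>z. norm (g z)"])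
    show "AE z in hartogs_measure. (\<lambda>n. ?s n z) \<longlonglongrightarrow> 0"
    proof (rule AE_I2)
      fix z assume "z \<in> space hartogs_measure"
      then have "z \<in> hartogs_triangle" by simp
      then have "0 < norm (z $ 2)"
        by (auto simp: hartogs_triangle_def intro: le_less_trans[OF norm_ge_zero])
      then have "\<forall>\<^sub>F n in sequentially. 1 / real (Suc n) < norm (z $ 2)"
        using order_tendstoD(2)[OF LIMSEQ_inverse_real_of_nat] by (simp add: inverse_eq_divide)
      then have "\<forall>\<^sub>F n in sequentially. ?s n z = 0"
        by eventually_elim (auto simp: indicator_def)
      then show "(\<lambda>n. ?s n z) \<longlonglongrightarrow> 0" by (rule tendsto_eventually)
    qed
    show "AE z in hartogs_measure. norm (?s n z) \<le> norm (g z)" for n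
      by (rule AE_I2) (simp add: indicator_def)
  qed (use m g in auto)
  then have "\<forall>\<^sub>F n in sequentially. (LINT z|hartogs_measure. ?s n z) < e"
    using e order_tendstoD(2) by fastforce
  then obtain n where "(LINT z|hartogs_measure. ?s n z) < e"
    by (auto dest: eventually_happens)
  then show ?thesis using that[of "1 / real (Suc n)"] by simp
qed

text \<open>
  A substitute for the inequalities of Hoelder and Jensen: values above the threshold \<open>t\<close> are absorbed by the
  \<open>p\<close>-th power. Integrating it and choosing \<open>t\<close> suitably bounds a mean by an \<open>L\<^sup>p\<close> norm.
\<close>

lemma le_threshold_plus_powr:
  fixes x t p :: real
  assumes "0 \<le> x" "0 < t" "1 \<le> p"
  shows "x \<le> t + t powr (1 - p) * x powr p"
proof (cases "x \<le> t")
  case True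
  then show ?thesis by (simp add: add_increasing2)
next
  case False
  then have "x = x powr (1 - p) * x powr p" using assms by (simp add: powr_add[symmetric])
  also have "\<dots> \<le> t powr (1 - p) * x powr p"
    using False assms by (intro mult_right_mono powr_mono2') auto
  finally show ?thesis using assms by simp
qed

text \<open>
  The point \<open>(0, w)\<close> is the centre of a polydisc inside the triangle with radii \<open>\<bar>w\<bar>/4\<close>, hence of volume
  proportional to \<open>\<bar>w\<bar>\<^sup>4\<close>. The mean value property gives the order \<open>\<bar>w\<bar> powr (-4/p)\<close>, and the limit is
  zero because these polydiscs shrink to the singular point, so that the integral of \<open>\<bar>f\<bar>\<^sup>p\<close> over
  them tends to zero.
\<close>

lemma axis_decay:
  assumes f: "holomorphic_fun_on f hartogs_triangle" and p: "1 \<le> p"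
    and int: "integrable hartogs_measure (\<lambda>z. norm (f z) powr p)"
  shows "((\<lambda>w. norm w powr (4 / p) * norm (f (axis 2 w))) \<longlongrightarrow> 0) (at 0)"
proof (rule tendstoI)
  fix e :: real assume e: "0 < e"
  define \<epsilon> where "\<epsilon> = e / 2"
  have \<epsilon>: "0 < \<epsilon>" using e by (simp add: \<epsilon>_def)
  define c where "c = measure lborel (polydisc 1) / 256"
  have c: "0 < c" using measure_polydisc_pos[of 1] by (simp add: c_def)
  let ?g = "\<lambda>z. norm (f z) powr p"
  have "0 < \<epsilon> * c / \<epsilon> powr (1 - p)" using \<epsilon> c by simp
  from integral_near_axis_small[OF int this] obtain r where r: "0 < r"
    and J: "(LINT z|hartogs_measure. indicator {z. norm (z $ 2) < r} z * ?g z) < \<epsilon> * c / \<epsilon> powr (1 - p)"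
    by blast
  define J where "J = (LINT z|hartogs_measure. indicator {z. norm (z $ 2) < r} z * ?g z)"
  have "norm w powr (4 / p) * norm (f (axis 2 w)) < e"
    if w: "w \<noteq> 0" "norm w < min (r / 2) (1 / 2)" for w
  proof -
    define s where "s = norm w"
    have s: "0 < s" "s < r / 2" "s < 1 / 2" using w by (auto simp: s_def)
    define D where "D = polydisc (s / 4)"
    define a where "a = (axis 2 w :: complex^2)"
    define M where "M = restrict_space lborel D"
    have D[measurable]: "D \<in> sets borel" by (simp add: D_def)
    have aD: "a + u \<in> hartogs_triangle" "norm ((a + u) $ 2) < r" if "u \<in> D" for u
    proof -
      have u: "norm (u $ 1) < s / 4" "norm (u $ 2) < s / 4" using that by (auto simp: D_def polydisc_def)
      have "norm w - norm (u $ 2) \<le> norm (w + u $ 2)" "norm (w + u $ 2) \<le> norm w + norm (u $ 2)"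
        using norm_diff_ineq norm_triangle_ineq by blast+
      then show "a + u \<in> hartogs_triangle" "norm ((a + u) $ 2) < r"
        using u s by (auto simp: a_def hartogs_triangle_def s_def[symmetric])
    qed
    have vol: "measure lborel D = c * s ^ 4"
      using measure_polydisc[of "s / 4"] s by (simp add: D_def c_def power_divide)
    have finM: "finite_measure M"
      by (rule finite_measureI) (use emeasure_bounded_finite[OF bounded_polydisc] D in
        \<open>auto simp: M_def D_def emeasure_restrict_space space_restrict_space less_top[symmetric]\<close>)
    \<comment> \<open>the threshold for which, after division by the volume of order \<open>s ^ 4\<close>, both summands are of order \<open>s powr (- 4 / p)\<close>\<close>
    define t where "t = \<epsilon> * s powr (- 4 / p)"
    have t: "0 < t" using \<epsilon> s by (simp add: t_def)
    have contf: "continuous_on D (\<lambda>u. f (a + u))"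
      by (rule continuous_on_compose2[OF holomorphic_fun_on_imp_continuous_on[OF f]])
         (use aD in \<open>auto intro!: continuous_intros\<close>)
    then have mf[measurable]: "(\<lambda>u. f (a + u)) \<in> borel_measurable M"
      unfolding M_def by (rule borel_measurable_restrict_lborel_continuous)
    let ?h = "\<lambda>z. indicator hartogs_triangle z * (indicator {z. norm (z $ 2) < r} z * ?g z)"
    have op: "{z::complex^2. norm (z $ 2) < r} \<in> sets borel"
      by (intro borel_open open_Collect_less continuous_intros)
    have intr: "integrable hartogs_measure (\<lambda>z. indicator {z. norm (z $ 2) < r} z * ?g z)"
    proof (rule Bochner_Integration.integrable_bound[OF int])
      have "(indicator {z. norm (z $ 2) < r} :: complex^2 \<Rightarrow> real) \<in> borel_measurable hartogs_measure"
        by (rule measurable_restrict_space1) (use op in simp)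
      then show "(\<lambda>z. indicator {z. norm (z $ 2) < r} z * ?g z) \<in> borel_measurable hartogs_measure"
        using borel_measurable_integrable[OF int] by (rule borel_measurable_times)
    qed (auto simp: indicator_def)
    have S: "hartogs_triangle \<inter> space lborel \<in> sets lborel" by simp
    have inth: "integrable lborel ?h"
      using intr integrable_restrict_space[OF S, of "\<lambda>z. indicator {z. norm (z $ 2) < r} z * ?g z"] by simp
    have Jh: "J = (LINT z|lborel. ?h z)"
      using integral_restrict_space[OF S, of "\<lambda>z. indicator {z. norm (z $ 2) < r} z * ?g z"]
      by (simp add: J_def)
    have plus: "(+) a \<in> measurable lborel borel" by simp
    have intsh: "integrable lborel (\<lambda>u. ?h (a + u))"
      by (rule integrable_distr[of "(+) a" lborel borel]) (use inth lborel_distr_plus[of a] in auto)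
    have Jsh: "J = (LINT u|lborel. ?h (a + u))"
      unfolding Jh using integral_distr[OF plus, of ?h] inth lborel_distr_plus[of a]
      by simp
    have SD: "D \<inter> space lborel \<in> sets lborel" by simp
    have bnd: "norm (indicator D u *\<^sub>R ?g (a + u)) \<le> norm (?h (a + u))" for u
      using aD[of u] by (auto simp: indicator_def)
    have "(\<lambda>u. ?g (a + u)) \<in> borel_measurable M" by measurable
    then have mD: "(\<lambda>u. indicator D u *\<^sub>R ?g (a + u)) \<in> borel_measurable lborel"
      unfolding M_def by (rule iffD1[OF borel_measurable_restrict_space_iff[OF SD]])
    have intD: "integrable lborel (\<lambda>u. indicator D u *\<^sub>R ?g (a + u))"
      by (rule Bochner_Integration.integrable_bound[OF intsh mD]) (use bnd in auto)
    then have intM: "integrable M (\<lambda>u. ?g (a + u))"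
      unfolding M_def using integrable_restrict_space[OF SD, of "\<lambda>u. ?g (a + u)"] by simp
    have "(LINT u|M. ?g (a + u)) = (LINT u|lborel. indicator D u *\<^sub>R ?g (a + u))"
      unfolding M_def by (rule integral_restrict_space[OF SD])
    also have "\<dots> \<le> J"
      unfolding Jsh by (rule integral_mono[OF intD intsh]) (use bnd in \<open>auto simp: abs_mult\<close>)
    finally have leJ: "(LINT u|M. ?g (a + u)) \<le> J" .
    have intb: "integrable M (\<lambda>u. t + t powr (1 - p) * ?g (a + u))"
      using finM intM by (auto intro!: finite_measure.integrable_const)
    have pt: "norm (f (a + u)) \<le> t + t powr (1 - p) * ?g (a + u)" for u
      by (rule le_threshold_plus_powr) (use t p in auto)
    have intf: "integrable M (\<lambda>u. f (a + u))"
      by (rule Bochner_Integration.integrable_bound[OF intb mf])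
         (use pt t in \<open>auto intro!: AE_I2 order_trans[OF pt]\<close>)
    have "norm (f a) * measure lborel D \<le> (LINT u|M. norm (f (a + u)))"
      unfolding M_def D_def
      by (rule norm_le_polydisc_mean[OF f]) (use aD intf in \<open>auto simp: M_def D_def\<close>)
    also have "\<dots> \<le> (LINT u|M. t + t powr (1 - p) * ?g (a + u))"
      by (rule integral_mono[OF integrable_norm[OF intf] intb pt])
    also have "\<dots> = t * measure lborel D + t powr (1 - p) * (LINT u|M. ?g (a + u))"
      using finM intM
      by (simp add: finite_measure.integrable_const M_def measure_restrict_space space_restrict_space mult.commute)
    also have "\<dots> \<le> t * measure lborel D + t powr (1 - p) * J"
      using leJ by (intro add_left_mono mult_left_mono) auto
    finally have main: "norm (f a) * (c * s ^ 4) \<le> t * (c * s ^ 4) + t powr (1 - p) * J"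
      by (simp add: vol)
    have st: "s powr (4 / p) * t = \<epsilon>"
      using s by (simp add: t_def powr_add[symmetric])
    have st2: "s powr (4 / p) * t powr (1 - p) = \<epsilon> powr (1 - p) * s ^ 4"
    proof -
      have "t powr (1 - p) = \<epsilon> powr (1 - p) * s powr ((- 4 / p) * (1 - p))"
        using \<epsilon> s by (simp add: t_def powr_mult powr_powr)
      then have "s powr (4 / p) * t powr (1 - p) = \<epsilon> powr (1 - p) * s powr (4 / p + (- 4 / p) * (1 - p))"
        by (simp only: powr_add mult_ac)
      also have "4 / p + (- 4 / p) * (1 - p) = 4" using p by (simp add: field_simps)
      also have "s powr 4 = s ^ 4" using s by simp
      finally show ?thesis .
    qed
    have "(s powr (4 / p) * norm (f a)) * (c * s ^ 4)
        \<le> (s powr (4 / p) * t) * (c * s ^ 4) + (s powr (4 / p) * t powr (1 - p)) * J"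
      using mult_left_mono[OF main, of "s powr (4 / p)"] by (simp add: algebra_simps)
    also have "\<dots> = (\<epsilon> + \<epsilon> powr (1 - p) * J / c) * (c * s ^ 4)"
      unfolding st st2 using c by (simp add: field_simps)
    finally have "s powr (4 / p) * norm (f a) \<le> \<epsilon> + \<epsilon> powr (1 - p) * J / c"
      using c s by (simp add: mult_le_cancel_right)
    also have "\<epsilon> powr (1 - p) * J / c < \<epsilon>"
      using J \<epsilon> c unfolding J_def[symmetric] by (simp add: field_simps)
    finally show ?thesis by (simp add: \<epsilon>_def s_def a_def)
  qed
  then show "\<forall>\<^sub>F w in at 0. dist (norm w powr (4 / p) * norm (f (axis 2 w))) 0 < e"
    unfolding eventually_at using r
    by (intro exI[of _ "min (r / 2) (1 / 2)"]) auto
qed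

section \<open>Square-integrable holomorphic functions\<close>

lemma hartogs_second_coord:
  assumes "z \<in> hartogs_triangle" shows "0 < norm (z $ 2)" "z $ 2 \<noteq> 0" "norm (z $ 2) < 1"
  using assms le_less_trans[OF norm_ge_zero[of "z $ 1"]] by (auto simp: hartogs_triangle_def)

lemma holomorphic_measurable_hartogs:
  "holomorphic_fun_on f hartogs_triangle \<Longrightarrow> f \<in> borel_measurable hartogs_measure"
  by (rule borel_measurable_restrict_lborel_continuous[OF holomorphic_fun_on_imp_continuous_on])

lemma measurable_lebesgue_on_hartogs:
  fixes f :: "complex^2 \<Rightarrow> complex"
  assumes "f \<in> borel_measurable hartogs_measure"
  shows "f \<in> borel_measurable (lebesgue_on hartogs_triangle)"
proof -
  have S: "hartogs_triangle \<inter> space lborel \<in> sets lborel"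
    "hartogs_triangle \<inter> space lebesgue \<in> sets lebesgue" by auto
  have "(\<lambda>x. indicator hartogs_triangle x *\<^sub>R f x) \<in> borel_measurable lborel"
    using iffD1[OF borel_measurable_restrict_space_iff[OF S(1)] assms] .
  then have "(\<lambda>x. indicator hartogs_triangle x *\<^sub>R f x) \<in> borel_measurable lebesgue"
    by (rule measurable_completion)
  then show ?thesis
    by (rule iffD2[OF borel_measurable_restrict_space_iff[OF S(2)]])
qed

lemma bergman_space_hartogs_iff:
  "f \<in> bergman_space (ereal p) hartogs_triangle \<longleftrightarrow>
     holomorphic_fun_on f hartogs_triangle \<and> integrable hartogs_measure (\<lambda>z. norm (f z) powr p)"
proof (cases "holomorphic_fun_on f hartogs_triangle")
  case True
  have [measurable]: "f \<in> borel_measurable hartogs_measure"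
    by (rule holomorphic_measurable_hartogs[OF True])
  have "integrable (lebesgue_on hartogs_triangle) (\<lambda>z. norm (f z) powr p)
      \<longleftrightarrow> integrable hartogs_measure (\<lambda>z. norm (f z) powr p)"
    by (rule integrable_lebesgue_on_iff_lborel) (auto, measurable)
  then show ?thesis
    using True measurable_lebesgue_on_hartogs[of f]
    by (auto simp: bergman_space_def lp_space_def)
qed (simp add: bergman_space_def)

lemma bergman_space_2_iff:
  "f \<in> bergman_space 2 hartogs_triangle \<longleftrightarrow>
     holomorphic_fun_on f hartogs_triangle \<and> integrable hartogs_measure (\<lambda>z. (norm (f z))\<^sup>2)"
  using bergman_space_hartogs_iff[of f 2] by simp

lemma bergman_2D:
  assumes "f \<in> bergman_space 2 hartogs_triangle"
  shows "holomorphic_fun_on f hartogs_triangle" "f \<in> borel_measurable hartogs_measure"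
    "integrable hartogs_measure (\<lambda>z. (norm (f z))\<^sup>2)"
  using assms[unfolded bergman_space_2_iff] holomorphic_measurable_hartogs by auto

lemma integrable_mult_square_integrable:
  fixes f g :: "'a \<Rightarrow> complex"
  assumes [measurable]: "f \<in> borel_measurable M" "g \<in> borel_measurable M"
    and "integrable M (\<lambda>z. (norm (f z))\<^sup>2)" "integrable M (\<lambda>z. (norm (g z))\<^sup>2)"
  shows "integrable M (\<lambda>z. f z * g z)"
proof (rule Bochner_Integration.integrable_bound)
  show "integrable M (\<lambda>z. (norm (f z))\<^sup>2 + (norm (g z))\<^sup>2)" using assms by simp
  show "AE z in M. norm (f z * g z) \<le> norm ((norm (f z))\<^sup>2 + (norm (g z))\<^sup>2)"
  proof (rule AE_I2)
    fix z
    have "2 * (norm (f z) * norm (g z)) \<le> (norm (f z))\<^sup>2 + (norm (g z))\<^sup>2"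
      using sum_squares_bound[of "norm (f z)" "norm (g z)"] by simp
    moreover have "0 \<le> norm (f z) * norm (g z)" by simp
    ultimately have "norm (f z) * norm (g z) \<le> (norm (f z))\<^sup>2 + (norm (g z))\<^sup>2"
      by linarith
    then show "norm (f z * g z) \<le> norm ((norm (f z))\<^sup>2 + (norm (g z))\<^sup>2)"
      by (simp add: norm_mult)
  qed
qed measurable

section \<open>Laurent coefficients along the axis\<close>

text \<open>
  The function \<open>w f(0, w)\<close>, extended by continuity to the origin.
\<close>

definition axis_profile :: "(complex^2 \<Rightarrow> complex) \<Rightarrow> complex \<Rightarrow> complex" where
  "axis_profile f w = (if w = 0 then Lim (at 0) (\<lambda>u. u * f (axis 2 u)) else w * f (axis 2 w))"

lemma holomorphic_on_axis:
  assumes "holomorphic_fun_on f hartogs_triangle"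
  shows "(\<lambda>w. f (axis 2 w)) holomorphic_on ball 0 1 - {0}"
proof -
  have *: "(0 + w *s axis 2 1 :: complex^2) = axis 2 w" for w
    by (simp add: vec_eq_iff forall_2)
  have "(\<lambda>w. f (0 + w *s axis 2 1)) holomorphic_on ball 0 1 - {0}"
    by (rule holomorphic_on_affine_line[OF assms]) (simp only: *, simp)
  then show ?thesis by (simp only: *)
qed

text \<open>
  The decay rate for \<open>p = 2\<close> says that \<open>w\<^sup>2 f(0, w)\<close> tends to zero. That function therefore extends
  holomorphically by zero, and can be divided by \<open>w\<close> once.
\<close>

lemma axis_profile_holomorphic:
  assumes f: "f \<in> bergman_space 2 hartogs_triangle"
  shows "axis_profile f holomorphic_on ball 0 1"
proof -
  define h where "h w = (if w = 0 then 0 else w\<^sup>2 * f (axis 2 w))" for w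
  have lim: "(h \<longlongrightarrow> h 0) (at 0)"
  proof -
    have "((\<lambda>w. norm w powr (4 / 2) * norm (f (axis 2 w))) \<longlongrightarrow> 0) (at 0)"
      by (rule axis_decay) (use bergman_2D[OF f] in auto)
    then have "((\<lambda>w. norm (w\<^sup>2 * f (axis 2 w))) \<longlongrightarrow> 0) (at 0)"
      by (simp add: norm_mult norm_power)
    then have "((\<lambda>w. w\<^sup>2 * f (axis 2 w)) \<longlongrightarrow> 0) (at 0)"
      by (rule tendsto_norm_zero_cancel)
    then have "(h \<longlongrightarrow> 0) (at 0)"
      by (rule Lim_transform_eventually) (auto simp: h_def eventually_at intro!: exI[of _ 1])
    moreover have "h 0 = 0" by (simp add: h_def)
    ultimately show ?thesis by simp
  qed
  have "h holomorphic_on ball 0 1"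
  proof (rule no_isolated_singularity'[where K="{0}"])
    show "(h \<longlongrightarrow> h z) (at z within ball 0 1)" if "z \<in> {0}" for z
      using lim that by (auto intro: tendsto_within_subset)
    have "(\<lambda>w. w\<^sup>2 * f (axis 2 w)) holomorphic_on ball 0 1 - {0}"
      by (intro holomorphic_intros holomorphic_on_axis bergman_2D(1)[OF f])
    then show "h holomorphic_on ball 0 1 - {0}"
      by (rule holomorphic_transform) (auto simp: h_def)
  qed auto
  from pole_lemma_open[OF this open_ball, of 0] obtain q where
    q: "q holomorphic_on ball 0 1" "\<And>w. w \<noteq> 0 \<Longrightarrow> q w = w * f (axis 2 w)"
  proof (rule that)
    fix w :: complex assume "w \<noteq> 0"
    then show "(if w = 0 then deriv h 0 else (h w - h 0) / (w - 0)) = w * f (axis 2 w)"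
      by (simp add: h_def power2_eq_square)
  qed
  have "(q \<longlongrightarrow> q 0) (at 0)"
    using holomorphic_on_imp_continuous_on[OF q(1)]
    by (simp add: continuous_on_eq_continuous_at isCont_def)
  then have "((\<lambda>w. w * f (axis 2 w)) \<longlongrightarrow> q 0) (at 0)"
    by (rule Lim_transform_eventually) (auto simp: q(2) eventually_at intro!: exI[of _ 1])
  then have "q 0 = axis_profile f 0"
    by (simp add: axis_profile_def tendsto_Lim)
  then have "q = axis_profile f"
    using q(2) by (auto simp: axis_profile_def)
  then show ?thesis using q(1) by simp
qed

text \<open>
  Index \<open>k\<close> belongs to the Laurent coefficient of \<open>w \<mapsto> f(0, w)\<close> of order \<open>k - 1\<close>; the shift
  avoids negative exponents.
\<close>

definition axis_coeff :: "(complex^2 \<Rightarrow> complex) \<Rightarrow> nat \<Rightarrow> complex" where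
  "axis_coeff f k = (deriv ^^ k) (axis_profile f) 0 / fact k"

lemma deriv2_mult:
  assumes "f holomorphic_on ball 0 1" "g holomorphic_on ball 0 1"
  shows "(deriv ^^ 2) (\<lambda>w. f w * g w) 0 / 2 =
     f 0 * ((deriv ^^ 2) g 0 / 2) + deriv f 0 * deriv g 0 + (deriv ^^ 2) f 0 / 2 * g (0::complex)"
proof -
  have "{0..2} = {0, 1, 2::nat}" by auto
  then show ?thesis
    by (subst higher_deriv_mult[OF assms open_ball]) (auto simp: field_simps)
qed

text \<open>
  For \<open>p = 4\<close> the decay rate is \<open>o(1 / \<bar>w\<bar>)\<close>, which excludes a pole.
\<close>

lemma axis_coeff_0_eq_0:
  assumes f: "f \<in> bergman_space 2 hartogs_triangle" "f \<in> bergman_space 4 hartogs_triangle"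
  shows "axis_coeff f 0 = 0"
proof -
  have "((\<lambda>w. norm w powr (4 / 4) * norm (f (axis 2 w))) \<longlongrightarrow> 0) (at 0)"
    by (rule axis_decay) (use f(2) bergman_space_hartogs_iff[of f 4] in auto)
  then have "((\<lambda>w. norm (w * f (axis 2 w))) \<longlongrightarrow> 0) (at 0)"
    by (simp add: norm_mult)
  then have "((\<lambda>w. w * f (axis 2 w)) \<longlongrightarrow> 0) (at 0)"
    by (rule tendsto_norm_zero_cancel)
  then show ?thesis by (simp add: axis_coeff_def axis_profile_def tendsto_Lim)
qed

section \<open>Monomials in the second coordinate\<close>

text \<open>
  The Laurent monomial of order \<open>k - 1\<close> in the second coordinate, matching the indexing of the
  coefficients.
\<close>

definition axis_monomial :: "nat \<Rightarrow> complex^2 \<Rightarrow> complex" where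
  "axis_monomial k z = (z $ 2) ^ k / z $ 2"

lemma axis_monomial_holomorphic: "holomorphic_fun_on (axis_monomial k) hartogs_triangle"
  unfolding axis_monomial_def[abs_def]
  by (rule holomorphic_fun_on_coordinate[of "\<lambda>w. w ^ k / w" "- {0}"])
     (auto intro!: holomorphic_intros simp: hartogs_second_coord)

lemma norm_axis_monomial_le:
  assumes "z \<in> hartogs_triangle"
  shows "norm (axis_monomial k z) \<le> 1 / norm (z $ 2)"
    and "1 \<le> k \<Longrightarrow> norm (axis_monomial k z) \<le> 1"
proof -
  note z = hartogs_second_coord[OF assms]
  have "norm (z $ 2) ^ k \<le> 1" using z by (simp add: power_le_one)
  then show "norm (axis_monomial k z) \<le> 1 / norm (z $ 2)"
    using z by (simp add: axis_monomial_def norm_divide norm_power divide_right_mono)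
  assume "1 \<le> k"
  then obtain m where "k = Suc m" by (cases k) auto
  then show "norm (axis_monomial k z) \<le> 1"
    using z by (simp add: axis_monomial_def norm_divide norm_power norm_mult power_le_one)
qed

lemma borel_measurable_vec_nth [measurable]:
  "(\<lambda>z::complex^2. z $ i) \<in> borel_measurable borel"
  by (intro borel_measurable_continuous_onI continuous_intros)

text \<open>
  The part of the triangle with \<open>\<bar>z\<^sub>2\<bar> \<le> 2\<^sup>-\<^sup>k\<close> lies in a polydisc and has volume of order \<open>16\<^sup>-\<^sup>k\<close>, while
  the integrand is at most \<open>2 powr (p (k + 1))\<close> for \<open>\<bar>z\<^sub>2\<bar> > 2 powr (-k - 1)\<close>. The resulting geometric series
  converges precisely for \<open>p < 4\<close>.
\<close>

lemma integrable_inverse_second_coord_powr: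
  assumes p: "0 \<le> p" "p < 4"
  shows "integrable hartogs_measure (\<lambda>z. (1 / norm (z $ 2)) powr p)"
proof (rule integrableI_bounded)
  define q where "q = 2 powr p"
  have q: "0 < q" "q < 16"
  proof -
    have "2 powr p < 2 powr (4::real)" using p by (intro powr_less_mono) auto
    then show "0 < q" "q < 16" by (auto simp: q_def)
  qed
  let ?A = "\<lambda>k. {z::complex^2. norm (z $ 1) < norm (z $ 2) \<and> norm (z $ 2) \<le> (1/2) ^ k}"
  define V where "V = measure lborel (polydisc 1)"
  have A: "?A k \<in> sets borel" for k
    by measurable
  have volA: "emeasure lborel (?A k) \<le> ennreal (16 * V * (1/16) ^ k)" for k
  proof -
    have "?A k \<subseteq> polydisc (2 * (1/2) ^ k)"
    proof
      fix z assume "z \<in> ?A k"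
      then have z: "norm (z $ 1) < norm (z $ 2)" "norm (z $ 2) \<le> (1/2) ^ k" by auto
      have "(1/2) ^ k < (2 * (1/2) ^ k :: real)" by simp
      from le_less_trans[OF z(2) this] less_trans[OF z(1) le_less_trans[OF z(2) this]]
      show "z \<in> polydisc (2 * (1/2) ^ k)" unfolding polydisc_def by blast
    qed
    then have "emeasure lborel (?A k) \<le> emeasure lborel (polydisc (2 * (1/2) ^ k))"
      by (intro emeasure_mono) auto
    also have "\<dots> = ennreal (measure lborel (polydisc (2 * (1/2) ^ k)))"
      by (rule emeasure_eq_ennreal_measure, rule less_imp_neq)
         (rule emeasure_bounded_finite[OF bounded_polydisc, unfolded infinity_ennreal_def])
    also have "measure lborel (polydisc (2 * (1/2) ^ k)) = 16 * V * (1/16) ^ k"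
    proof -
      have "((1/2::real) ^ k) ^ 4 = ((1/2) ^ 4) ^ k"
        by (simp only: power_mult[symmetric] mult.commute)
      also have "(1/2::real) ^ 4 = 1/16" by (simp add: power_divide)
      finally have "(2 * (1/2) ^ k) ^ 4 = 16 * (1/16 :: real) ^ k"
        by (simp only: power_mult_distrib) simp
      then show ?thesis by (subst measure_polydisc) (simp_all add: V_def)
    qed
    finally show ?thesis .
  qed
  show "(\<lambda>z. (1 / norm (z $ 2)) powr p) \<in> borel_measurable hartogs_measure"
    by (rule measurable_restrict_space1) measurable
  have "(\<integral>\<^sup>+z. ennreal (norm ((1 / norm (z $ 2)) powr p)) \<partial>hartogs_measure)
      = (\<integral>\<^sup>+z. ennreal ((1 / norm (z $ 2)) powr p) * indicator hartogs_triangle z \<partial>lborel)"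
    by (subst nn_integral_restrict_space) auto
  also have "\<dots> \<le> (\<integral>\<^sup>+z. (\<Sum>k. ennreal (q ^ Suc k) * indicator (?A k) z) \<partial>lborel)"
  proof (rule nn_integral_mono)
    have le_suminf: "g k \<le> suminf g" for g :: "nat \<Rightarrow> ennreal" and k
      using sum_le_suminf[of g "{k}"] by simp
    fix z :: "complex^2"
    show "ennreal ((1 / norm (z $ 2)) powr p) * indicator hartogs_triangle z
        \<le> (\<Sum>k. ennreal (q ^ Suc k) * indicator (?A k) z)"
    proof (cases "z \<in> hartogs_triangle")
      case True
      note z = hartogs_second_coord[OF True]
      define n where "n = (LEAST n. (1/2) ^ n < norm (z $ 2))"
      have ex: "\<exists>n. (1/2) ^ n < norm (z $ 2)" using z by (intro real_arch_pow_inv) auto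
      have n: "(1/2) ^ n < norm (z $ 2)" unfolding n_def by (rule LeastI_ex[OF ex])
      have "n \<noteq> 0"
      proof
        assume "n = 0"
        with n show False using z(3) by simp
      qed
      then obtain k where k: "n = Suc k" by (cases n) auto
      have "\<not> (1/2) ^ k < norm (z $ 2)"
        by (rule not_less_Least) (use k in \<open>simp add: n_def[symmetric]\<close>)
      then have zA: "z \<in> ?A k" using True by (simp add: hartogs_triangle_def)
      have "1 / 2 ^ Suc k < norm (z $ 2)" using n unfolding k power_one_over .
      then have "1 < norm (z $ 2) * 2 ^ Suc k" by (subst (asm) pos_divide_less_eq) auto
      then have "1 / norm (z $ 2) \<le> 2 ^ Suc k"
        using z(1) by (subst pos_divide_le_eq) (auto simp: mult.commute)
      then have "(1 / norm (z $ 2)) powr p \<le> (2 ^ Suc k) powr p"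
        using p z by (intro powr_mono2) auto
      also have "\<dots> = (2 powr real (Suc k)) powr p" by (subst powr_realpow) auto
      also have "\<dots> = (2 powr p) powr real (Suc k)" by (simp only: powr_powr mult.commute)
      also have "\<dots> = q ^ Suc k" unfolding q_def by (rule powr_realpow) simp
      finally have "ennreal ((1 / norm (z $ 2)) powr p) * indicator hartogs_triangle z
          \<le> ennreal (q ^ Suc k) * indicator (?A k) z"
        using True zA by (simp add: ennreal_leI)
      also have "\<dots> \<le> (\<Sum>k. ennreal (q ^ Suc k) * indicator (?A k) z)"
        by (rule le_suminf)
      finally show ?thesis .
    qed simp
  qed
  also have "\<dots> = (\<Sum>k. \<integral>\<^sup>+z. ennreal (q ^ Suc k) * indicator (?A k) z \<partial>lborel)"
    by (rule nn_integral_suminf) (use A in auto)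
  also have "\<dots> = (\<Sum>k. ennreal (q ^ Suc k) * emeasure lborel (?A k))"
    by (intro suminf_cong nn_integral_cmult_indicator) (use A in auto)
  also have "\<dots> \<le> (\<Sum>k. ennreal (16 * V * q * (q / 16) ^ k))"
  proof (intro suminf_le allI)
    fix k
    have "ennreal (q ^ Suc k) * emeasure lborel (?A k) \<le> ennreal (q ^ Suc k) * ennreal (16 * V * (1/16) ^ k)"
      by (intro mult_left_mono volA) auto
    also have "\<dots> = ennreal (16 * V * q * (q / 16) ^ k)"
      using q by (simp add: ennreal_mult'[symmetric] power_divide field_simps)
    finally show "ennreal (q ^ Suc k) * emeasure lborel (?A k) \<le> ennreal (16 * V * q * (q / 16) ^ k)" .
  qed auto
  also have "\<dots> < \<infinity>"
  proof -
    have "summable (\<lambda>k. 16 * V * q * (q / 16) ^ k)"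
      using q by (intro summable_mult summable_geometric) auto
    then show ?thesis
      using q by (subst suminf_ennreal2) (auto simp: V_def)
  qed
  finally show "(\<integral>\<^sup>+z. ennreal (norm ((1 / norm (z $ 2)) powr p)) \<partial>hartogs_measure) < \<infinity>" .
qed

lemma borel_measurable_cnj [measurable]:
  "f \<in> borel_measurable M \<Longrightarrow> (\<lambda>z. cnj (f z)) \<in> borel_measurable M"
  by (erule measurable_compose)
     (rule borel_measurable_continuous_onI[OF continuous_on_cnj[OF continuous_on_id]])

lemma axis_monomial_bergman:
  "axis_monomial k \<in> bergman_space 2 hartogs_triangle"
proof -
  have "integrable hartogs_measure (\<lambda>z. (norm (axis_monomial k z))\<^sup>2)"
  proof (rule Bochner_Integration.integrable_bound)
    show "integrable hartogs_measure (\<lambda>z. (1 / norm (z $ 2)) powr 2)"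
      by (rule integrable_inverse_second_coord_powr) auto
    show "(\<lambda>z. (norm (axis_monomial k z))\<^sup>2) \<in> borel_measurable hartogs_measure"
      using holomorphic_measurable_hartogs[OF axis_monomial_holomorphic[of k]] by measurable
    show "AE z in hartogs_measure. norm ((norm (axis_monomial k z))\<^sup>2) \<le> norm ((1 / norm (z $ 2)) powr 2)"
    proof (rule AE_I2)
      fix z assume "z \<in> space hartogs_measure"
      then have z: "z \<in> hartogs_triangle" by simp
      have "(norm (axis_monomial k z))\<^sup>2 \<le> (1 / norm (z $ 2))\<^sup>2"
        using norm_axis_monomial_le(1)[OF z, of k] by (intro power_mono) auto
      then show "norm ((norm (axis_monomial k z))\<^sup>2) \<le> norm ((1 / norm (z $ 2)) powr 2)"
        by simp
    qed
  qed
  then show ?thesis using axis_monomial_holomorphic by (simp only: bergman_space_2_iff)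
qed

section \<open>Pairings and Laurent coefficients\<close>

definition hartogs_volume :: real where
  "hartogs_volume = measure lborel hartogs_triangle"

definition monomial_norm_sq :: "nat \<Rightarrow> real" where
  "monomial_norm_sq k = (LINT z|hartogs_measure. (norm (axis_monomial k z))\<^sup>2)"

lemma hartogs_volume_pos: "0 < hartogs_volume"
  using emeasure_hartogs_pos emeasure_hartogs_finite
  by (simp add: hartogs_volume_def measure_def enn2real_positive_iff)

lemma measure_hartogs_measure: "measure hartogs_measure hartogs_triangle = hartogs_volume"
  by (simp add: hartogs_volume_def measure_restrict_space)

text \<open>
  The exceptional set is open and null, hence empty.
\<close>

lemma AE_hartogs_zero_imp_zero:
  fixes d :: "complex^2 \<Rightarrow> complex"
  assumes d: "continuous_on hartogs_triangle d" and ae: "AE z in hartogs_measure. d z = 0"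
    and z: "z \<in> hartogs_triangle"
  shows "d z = 0"
proof -
  let ?N = "{z \<in> hartogs_triangle. d z \<noteq> 0}"
  have "open (- {0::complex})" by auto
  then have "open (d -` (- {0}) \<inter> hartogs_triangle)"
    using d open_hartogs_triangle continuous_on_open_vimage by blast
  moreover have "d -` (- {0}) \<inter> hartogs_triangle = ?N" by auto
  ultimately have op: "open ?N" by simp
  have "AE z in lborel. z \<in> hartogs_triangle \<longrightarrow> d z = 0"
    using ae by (subst (asm) AE_restrict_space_iff) auto
  then have "?N \<in> null_sets lborel"
    using op by (subst (asm) AE_iff_null_sets[symmetric, of ?N, simplified]) (auto elim: eventually_mono)
  then have "?N \<in> null_sets lebesgue" by (rule null_sets_completionI)
  then have "?N = {}"
    using open_not_negligible[OF op] by (auto simp: negligible_iff_null_sets)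
  then show ?thesis using z by auto
qed

lemma monomial_norm_sq_pos: "0 < monomial_norm_sq k"
proof -
  have "monomial_norm_sq k \<noteq> 0"
  proof
    assume "monomial_norm_sq k = 0"
    then have "AE z in hartogs_measure. (norm (axis_monomial k z))\<^sup>2 = 0"
      using integral_nonneg_eq_0_iff_AE[OF bergman_2D(3)[OF axis_monomial_bergman[of k]]]
      by (simp add: monomial_norm_sq_def)
    then have "AE z in hartogs_measure. axis_monomial k z = 0" by simp
    from AE_hartogs_zero_imp_zero[OF holomorphic_fun_on_imp_continuous_on[OF axis_monomial_holomorphic] this, of "axis 2 (1/2)"]
    show False by (simp add: axis_monomial_def)
  qed
  moreover have "0 \<le> monomial_norm_sq k" by (simp add: monomial_norm_sq_def)
  ultimately show ?thesis by simp
qed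

lemma axis_profile_eq: "w \<noteq> 0 \<Longrightarrow> axis_profile f w = w * f (axis 2 w)"
  by (simp add: axis_profile_def)

text \<open>
  The constant Laurent coefficient of \<open>f(0, w) g(0, w)\<close> pairs orders that add up to zero, so only
  the orders \<open>-1, 0, 1\<close> enter: neither factor has a pole of order two.
\<close>

lemma integral_mult_eq_sum_axis_coeff:
  assumes f: "f \<in> bergman_space 2 hartogs_triangle" and g: "g \<in> bergman_space 2 hartogs_triangle"
  shows "(LINT z|hartogs_measure. f z * g z) = hartogs_volume * (\<Sum>k\<le>2. axis_coeff f (2 - k) * axis_coeff g k)"
proof -
  let ?F = "axis_profile f" and ?G = "axis_profile g"
  note hol = axis_profile_holomorphic[OF f] axis_profile_holomorphic[OF g]
  have "(LINT z|hartogs_measure. of_real 1 * (f z * g z))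
     = (deriv ^^ 2) (\<lambda>u. ?F u * ?G u) 0 / 2 * of_real (LINT z|hartogs_measure. 1)"
  proof (rule integral_radial_weight_mult_holomorphic)
    show "holomorphic_fun_on (\<lambda>z. f z * g z) hartogs_triangle"
      by (rule holomorphic_fun_on_mult[OF bergman_2D(1)[OF f] bergman_2D(1)[OF g]])
    show "(\<lambda>u. ?F u * ?G u) holomorphic_on ball 0 1" using hol by (intro holomorphic_intros)
    show "f (axis 2 u) * g (axis 2 u) = ?F u * ?G u / u\<^sup>2" if "0 < norm u" for u
      using that by (simp add: axis_profile_eq power2_eq_square)
    show "integrable hartogs_measure (\<lambda>z. of_real 1 * (f z * g z))"
      using integrable_mult_square_integrable[OF bergman_2D(2)[OF f] bergman_2D(2)[OF g]
          bergman_2D(3)[OF f] bergman_2D(3)[OF g]] by simp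
  qed
  moreover have "(LINT z|hartogs_measure. 1) = hartogs_volume"
    by (simp add: measure_hartogs_measure)
  moreover have "{..2} = {0, 1, 2::nat}" by auto
  ultimately show ?thesis
    by (simp add: deriv2_mult[OF hol] axis_coeff_def numeral_2_eq_2[symmetric] algebra_simps)
qed

text \<open>
  Since the conjugate of \<open>e\<^sub>k\<close> is \<open>\<bar>e\<^sub>k\<bar>\<^sup>2 / e\<^sub>k\<close>, the integrand is a radial weight times the function
  \<open>g / e\<^sub>k\<close>, which is holomorphic on the triangle.
\<close>

lemma integral_cnj_monomial_mult:
  assumes g: "g \<in> bergman_space 2 hartogs_triangle" and k: "k \<le> 2"
  shows "(LINT z|hartogs_measure. cnj (axis_monomial k z) * g z) = monomial_norm_sq k * axis_coeff g k"
proof -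
  let ?G = "axis_profile g"
  define w where "w s = (s ^ k / s)\<^sup>2" for s :: real
  define h where "h z = g z * (z $ 2 / (z $ 2) ^ k)" for z
  have wN: "w (norm (z $ 2)) = (norm (axis_monomial k z))\<^sup>2" for z
    by (simp add: w_def axis_monomial_def norm_divide norm_power)
  have eq: "of_real (w (norm (z $ 2))) * h z = cnj (axis_monomial k z) * g z"
    if "z \<in> hartogs_triangle" for z
  proof -
    have z: "z $ 2 \<noteq> 0" using hartogs_second_coord[OF that] by simp
    then have "axis_monomial k z * (z $ 2 / (z $ 2) ^ k) = 1" by (simp add: axis_monomial_def)
    moreover have "(axis_monomial k z * cnj (axis_monomial k z)) * h z
        = (axis_monomial k z * (z $ 2 / (z $ 2) ^ k)) * (cnj (axis_monomial k z) * g z)"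
      by (simp only: h_def mult_ac)
    ultimately have "(axis_monomial k z * cnj (axis_monomial k z)) * h z = cnj (axis_monomial k z) * g z"
      by (simp only: mult_1_left)
    then show ?thesis by (simp only: wN complex_norm_square)
  qed
  have int: "integrable hartogs_measure (\<lambda>z. cnj (axis_monomial k z) * g z)"
  proof (rule integrable_mult_square_integrable)
    show "(\<lambda>z. cnj (axis_monomial k z)) \<in> borel_measurable hartogs_measure"
      using bergman_2D(2)[OF axis_monomial_bergman[of k]] by measurable
  qed (use bergman_2D[OF g] bergman_2D[OF axis_monomial_bergman[of k]] in auto)
  have "(LINT z|hartogs_measure. of_real (w (norm (z $ 2))) * h z)
     = (deriv ^^ 2) (\<lambda>u. ?G u * u ^ (2 - k)) 0 / 2 * of_real (LINT z|hartogs_measure. w (norm (z $ 2)))"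
  proof (rule integral_radial_weight_mult_holomorphic)
    have "holomorphic_fun_on (\<lambda>z::complex^2. z $ 2 / (z $ 2) ^ k) hartogs_triangle"
      by (rule holomorphic_fun_on_coordinate[of "\<lambda>w. w / w ^ k" "- {0}"])
         (auto intro!: holomorphic_intros simp: hartogs_second_coord)
    then show "holomorphic_fun_on h hartogs_triangle"
      unfolding h_def by (rule holomorphic_fun_on_mult[OF bergman_2D(1)[OF g]])
    show "(\<lambda>u. ?G u * u ^ (2 - k)) holomorphic_on ball 0 1"
      by (intro holomorphic_intros axis_profile_holomorphic g)
    show "h (axis 2 u) = ?G u * u ^ (2 - k) / u\<^sup>2" if "0 < norm u" for u
    proof -
      have "u\<^sup>2 = u ^ k * u ^ (2 - k)" using k by (simp add: power_add[symmetric])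
      then show ?thesis using that by (simp add: h_def axis_profile_eq)
    qed
    show "integrable hartogs_measure (\<lambda>z. of_real (w (norm (z $ 2))) * h z)"
      using int by (subst Bochner_Integration.integrable_cong[OF refl eq]) auto
  qed
  moreover have "(LINT z|hartogs_measure. of_real (w (norm (z $ 2))) * h z)
      = (LINT z|hartogs_measure. cnj (axis_monomial k z) * g z)"
    by (rule Bochner_Integration.integral_cong) (auto simp: eq)
  moreover have "(deriv ^^ 2) (\<lambda>u. ?G u * u ^ (2 - k)) 0 / 2 = axis_coeff g k"
  proof -
    have "k = 0 \<or> k = 1 \<or> k = 2" using k by auto
    moreover have "(deriv ^^ 2) (\<lambda>u. u\<^sup>2) 0 = (2::complex)"
      "deriv (\<lambda>u. u\<^sup>2) 0 = (0::complex)"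
    proof -
      have d: "deriv (\<lambda>u. u\<^sup>2) = (\<lambda>u::complex. 2 * u)"
        by (rule ext) (auto intro!: DERIV_imp_deriv derivative_eq_intros)
      show "deriv (\<lambda>u. u\<^sup>2) 0 = (0::complex)" by (simp add: d)
      have "deriv (\<lambda>u::complex. 2 * u) 0 = 2"
        by (rule DERIV_imp_deriv) (auto intro!: derivative_eq_intros)
      moreover have "(deriv ^^ 2) g = deriv (deriv g)" for g :: "complex \<Rightarrow> complex"
        by (simp add: numeral_2_eq_2)
      ultimately show "(deriv ^^ 2) (\<lambda>u. u\<^sup>2) 0 = (2::complex)" by (simp only: d)
    qed
    ultimately show ?thesis
      by (subst deriv2_mult[OF axis_profile_holomorphic[OF g]])
         (auto simp: axis_coeff_def intro!: holomorphic_intros)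
  qed
  ultimately show ?thesis by (simp add: wN monomial_norm_sq_def mult.commute)
qed

section \<open>The Friedrichs operator\<close>

text \<open>
  The value zero outside the triangle is the normalisation used for the Bergman projection.
\<close>

definition monomial_combination :: "(nat \<Rightarrow> complex) \<Rightarrow> complex^2 \<Rightarrow> complex" where
  "monomial_combination c z = (if z \<in> hartogs_triangle then \<Sum>k\<le>2. c k * axis_monomial k z else 0)"

lemma atMost_2: "{..2} = {0, 1, 2::nat}" by auto

lemma monomial_combination_holomorphic: "holomorphic_fun_on (monomial_combination c) hartogs_triangle"
proof (rule holomorphic_fun_on_cong[OF open_hartogs_triangle])
  show "holomorphic_fun_on (\<lambda>z::complex^2. (\<lambda>w. \<Sum>k\<le>2. c k * (w ^ k / w)) (z $ 2)) hartogs_triangle"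
    by (rule holomorphic_fun_on_coordinate[of _ "- {0}"])
       (auto intro!: holomorphic_intros simp: hartogs_second_coord)
qed (simp add: monomial_combination_def axis_monomial_def)

lemma norm_monomial_combination_le:
  assumes z: "z \<in> hartogs_triangle"
  shows "norm (monomial_combination c z) \<le> (\<Sum>k\<le>2. norm (c k)) * (1 / norm (z $ 2))"
    and "c 0 = 0 \<Longrightarrow> norm (monomial_combination c z) \<le> (\<Sum>k\<le>2. norm (c k))"
proof -
  have "norm (monomial_combination c z) \<le> (\<Sum>k\<le>2. norm (c k * axis_monomial k z))"
    using z unfolding monomial_combination_def by (simp only: if_True norm_sum)
  also have "\<dots> \<le> (\<Sum>k\<le>2. norm (c k) * (1 / norm (z $ 2)))"
    unfolding norm_mult by (intro sum_mono mult_left_mono norm_axis_monomial_le z) auto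
  finally show "norm (monomial_combination c z) \<le> (\<Sum>k\<le>2. norm (c k)) * (1 / norm (z $ 2))"
    by (simp only: sum_distrib_right)
  assume c: "c 0 = 0"
  have "norm (monomial_combination c z) \<le> (\<Sum>k\<le>2. norm (c k * axis_monomial k z))"
    using z unfolding monomial_combination_def by (simp only: if_True norm_sum)
  also have "\<dots> \<le> (\<Sum>k\<le>2. norm (c k))"
  proof (rule sum_mono)
    fix k :: nat
    show "norm (c k * axis_monomial k z) \<le> norm (c k)"
      using norm_axis_monomial_le(2)[OF z, of k] c
      by (cases "k = 0") (auto simp: norm_mult intro: mult_left_le)
  qed
  finally show "norm (monomial_combination c z) \<le> (\<Sum>k\<le>2. norm (c k))" .
qed

lemma integrable_powr_monomial_combination:
  assumes p: "0 \<le> p" "p < 4"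
  shows "integrable hartogs_measure (\<lambda>z. norm (monomial_combination c z) powr p)"
proof (rule Bochner_Integration.integrable_bound)
  let ?C = "\<Sum>k\<le>2. norm (c k)"
  show "integrable hartogs_measure (\<lambda>z. ?C powr p * (1 / norm (z $ 2)) powr p)"
    by (intro integrable_mult_right integrable_inverse_second_coord_powr p)
  show "(\<lambda>z. norm (monomial_combination c z) powr p) \<in> borel_measurable hartogs_measure"
    using holomorphic_measurable_hartogs[OF monomial_combination_holomorphic[of c]] by measurable
  show "AE z in hartogs_measure. norm (norm (monomial_combination c z) powr p)
      \<le> norm (?C powr p * (1 / norm (z $ 2)) powr p)"
  proof (rule AE_I2)
    fix z assume "z \<in> space hartogs_measure"
    then have z: "z \<in> hartogs_triangle" by simp
    have "norm (monomial_combination c z) powr p \<le> (?C * (1 / norm (z $ 2))) powr p"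
      by (intro powr_mono2 norm_monomial_combination_le z p) auto
    also have "\<dots> = ?C powr p * (1 / norm (z $ 2)) powr p"
      by (rule powr_mult)
    finally show "norm (norm (monomial_combination c z) powr p)
      \<le> norm (?C powr p * (1 / norm (z $ 2)) powr p)" by simp
  qed
qed

lemma monomial_combination_bergman: "monomial_combination c \<in> bergman_space 2 hartogs_triangle"
  using integrable_powr_monomial_combination[of 2 c] monomial_combination_holomorphic
  by (simp add: bergman_space_2_iff del: numeral_eq_ereal)

text \<open>
  The profile of the combination is the polynomial with coefficients \<open>c\<close>. At the origin this uses
  continuity, because the profile is defined there as a limit.
\<close>

lemma axis_coeff_monomial_combination:
  assumes "k \<le> 2"
  shows "axis_coeff (monomial_combination c) k = c k"
proof -
  let ?P = "\<lambda>u. c 0 + c 1 * u + c 2 * u\<^sup>2"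
  let ?F = "axis_profile (monomial_combination c)"
  have hol: "?F holomorphic_on ball 0 1"
    by (rule axis_profile_holomorphic[OF monomial_combination_bergman])
  have off: "?F u = ?P u" if "u \<in> ball 0 1" "u \<noteq> 0" for u
    using that by (simp add: axis_profile_eq monomial_combination_def axis_monomial_def atMost_2 field_simps power2_eq_square)
  have "?F 0 = ?P 0"
  proof -
    have "(?F \<longlongrightarrow> ?F 0) (at 0)"
      using holomorphic_on_imp_continuous_on[OF hol]
      by (simp add: continuous_on_eq_continuous_at isCont_def)
    moreover have "\<forall>\<^sub>F u in at 0. ?F u = ?P u"
      unfolding eventually_at by (rule exI[of _ 1]) (use off in auto)
    ultimately have "(?P \<longlongrightarrow> ?F 0) (at 0)"
      by (rule Lim_transform_eventually)
    moreover have "(?P \<longlongrightarrow> ?P 0) (at 0)" by (intro tendsto_intros)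
    ultimately show ?thesis by (rule LIM_unique)
  qed
  then have eq: "?F u = ?P u" if "u \<in> ball 0 1" for u
    using off[OF that] by (cases "u = 0") auto
  have d: "(deriv ^^ k) ?F 0 = (deriv ^^ k) ?P 0"
    by (rule higher_deriv_transform_within_open[OF hol _ open_ball])
       (use eq in \<open>auto intro!: holomorphic_intros\<close>)
  have d1: "deriv ?P = (\<lambda>u. c 1 + 2 * c 2 * u)"
    by (rule ext, rule DERIV_imp_deriv) (auto intro!: derivative_eq_intros)
  have d2: "deriv (\<lambda>u. c 1 + 2 * c 2 * u) 0 = 2 * c 2"
    by (rule DERIV_imp_deriv) (auto intro!: derivative_eq_intros)
  have "k = 0 \<or> k = Suc 0 \<or> k = Suc (Suc 0)" using assms by auto
  then show ?thesis
    unfolding axis_coeff_def d using d1 d2 by (auto simp: numeral_2_eq_2)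
qed

text \<open>
  If \<open>h\<close> and \<open>k\<close> both satisfy the orthogonality relations, their difference \<open>d\<close> lies in \<open>A\<^sup>2\<close> and is
  orthogonal to itself, so that it vanishes almost everywhere and, being continuous, everywhere.
\<close>

lemma bergman_projection_hartogs_eqI:
  assumes u: "u \<in> borel_measurable hartogs_measure" "integrable hartogs_measure (\<lambda>z. (norm (u z))\<^sup>2)"
    and h: "h \<in> bergman_space 2 hartogs_triangle" "\<And>z. z \<notin> hartogs_triangle \<Longrightarrow> h z = 0"
    and orth: "\<And>g. g \<in> bergman_space 2 hartogs_triangle \<Longrightarrow>
      (LINT z|hartogs_measure. u z * cnj (g z)) = (LINT z|hartogs_measure. h z * cnj (g z))"
  shows "bergman_projection hartogs_triangle u = h"
proof -
  have int: "integrable hartogs_measure (\<lambda>z. v z * cnj (g z))"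
    if "v \<in> borel_measurable hartogs_measure" "integrable hartogs_measure (\<lambda>z. (norm (v z))\<^sup>2)"
      "g \<in> bergman_space 2 hartogs_triangle" for v g
  proof (rule integrable_mult_square_integrable)
    show "(\<lambda>z. cnj (g z)) \<in> borel_measurable hartogs_measure"
      using bergman_2D(2)[OF that(3)] by measurable
  qed (use that bergman_2D(3)[OF that(3)] in auto)
  have inner: "l2_inner hartogs_triangle (\<lambda>z. u z - k z) g =
      (LINT z|hartogs_measure. u z * cnj (g z)) - (LINT z|hartogs_measure. k z * cnj (g z))"
    if k: "k \<in> bergman_space 2 hartogs_triangle" and g: "g \<in> bergman_space 2 hartogs_triangle" for k g
  proof -
    have [measurable]: "u \<in> borel_measurable hartogs_measure" "k \<in> borel_measurable hartogs_measure"
      "g \<in> borel_measurable hartogs_measure"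
      using u bergman_2D(2)[OF k] bergman_2D(2)[OF g] by auto
    have "l2_inner hartogs_triangle (\<lambda>z. u z - k z) g = (LINT z|hartogs_measure. (u z - k z) * cnj (g z))"
      unfolding l2_inner_def by (rule integral_lebesgue_on_eq_lborel) (simp, measurable)
    also have "\<dots> = (LINT z|hartogs_measure. u z * cnj (g z) - k z * cnj (g z))"
      by (simp add: algebra_simps)
    also have "\<dots> = (LINT z|hartogs_measure. u z * cnj (g z)) - (LINT z|hartogs_measure. k z * cnj (g z))"
      by (intro Bochner_Integration.integral_diff int u g bergman_2D[OF k])
    finally show ?thesis .
  qed
  show ?thesis unfolding bergman_projection_def
  proof (rule the_equality)
    show "h \<in> bergman_space 2 hartogs_triangle \<and> (\<forall>z. z \<notin> hartogs_triangle \<longrightarrow> h z = 0) \<and>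
        (\<forall>g\<in>bergman_space 2 hartogs_triangle. l2_inner hartogs_triangle (\<lambda>z. u z - h z) g = 0)"
      using h orth inner[OF h(1)] by auto
  next
    fix k assume "k \<in> bergman_space 2 hartogs_triangle \<and> (\<forall>z. z \<notin> hartogs_triangle \<longrightarrow> k z = 0) \<and>
        (\<forall>g\<in>bergman_space 2 hartogs_triangle. l2_inner hartogs_triangle (\<lambda>z. u z - k z) g = 0)"
    then have k: "k \<in> bergman_space 2 hartogs_triangle" "\<And>z. z \<notin> hartogs_triangle \<Longrightarrow> k z = 0"
      and ko: "\<And>g. g \<in> bergman_space 2 hartogs_triangle \<Longrightarrow>
        (LINT z|hartogs_measure. u z * cnj (g z)) = (LINT z|hartogs_measure. k z * cnj (g z))"
      using inner by auto
    define d where "d z = k z - h z" for z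
    have d: "d \<in> bergman_space 2 hartogs_triangle"
    proof -
      have "holomorphic_fun_on d hartogs_triangle"
        unfolding d_def by (rule holomorphic_fun_on_diff) (use bergman_2D k h in auto)
      moreover have "integrable hartogs_measure (\<lambda>z. (norm (d z))\<^sup>2)"
      proof (rule Bochner_Integration.integrable_bound)
        show "integrable hartogs_measure (\<lambda>z. 2 * (norm (k z))\<^sup>2 + 2 * (norm (h z))\<^sup>2)"
          using bergman_2D(3)[OF k(1)] bergman_2D(3)[OF h(1)] by auto
        show "(\<lambda>z. (norm (d z))\<^sup>2) \<in> borel_measurable hartogs_measure"
          using bergman_2D(2)[OF k(1)] bergman_2D(2)[OF h(1)] unfolding d_def by measurable
        have "(norm (d z))\<^sup>2 \<le> 2 * (norm (k z))\<^sup>2 + 2 * (norm (h z))\<^sup>2" for z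
        proof -
          have "(norm (d z))\<^sup>2 \<le> (norm (k z) + norm (h z))\<^sup>2"
            unfolding d_def by (intro power_mono norm_triangle_ineq4) auto
          also have "\<dots> \<le> 2 * (norm (k z))\<^sup>2 + 2 * (norm (h z))\<^sup>2"
            using sum_squares_bound[of "norm (k z)" "norm (h z)"] by (simp add: power2_sum)
          finally show ?thesis .
        qed
        then show "AE z in hartogs_measure. norm ((norm (d z))\<^sup>2) \<le> norm (2 * (norm (k z))\<^sup>2 + 2 * (norm (h z))\<^sup>2)"
          by simp
      qed
      ultimately show ?thesis by (simp only: bergman_space_2_iff)
    qed
    have "(LINT z|hartogs_measure. of_real ((norm (d z))\<^sup>2) :: complex) = (LINT z|hartogs_measure. k z * cnj (d z) - h z * cnj (d z))"
      by (simp only: complex_norm_square d_def left_diff_distrib)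
    also have "\<dots> = 0"
      using ko[OF d] orth[OF d] by (subst Bochner_Integration.integral_diff) (auto intro!: int bergman_2D k h d)
    finally have "(LINT z|hartogs_measure. (norm (d z))\<^sup>2) = 0"
      by (simp del: of_real_power)
    then have "AE z in hartogs_measure. d z = 0"
      using integral_nonneg_eq_0_iff_AE[OF bergman_2D(3)[OF d]] by simp
    from AE_hartogs_zero_imp_zero[OF holomorphic_fun_on_imp_continuous_on[OF bergman_2D(1)[OF d]] this]
    have "k z = h z" for z
      using k(2)[of z] h(2)[of z] by (cases "z \<in> hartogs_triangle") (auto simp: d_def)
    then show "k = h" by auto
  qed
qed

text \<open>
  For \<open>g \<in> A\<^sup>2\<close>, the inner product of the conjugate of \<open>f\<close> with \<open>g\<close> is the conjugate of the integral of \<open>f g\<close>, which is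
  a sum over three coefficients of \<open>g\<close>. Each of these is an inner product of \<open>g\<close> with a monomial,
  which identifies the combination that represents the functional.
\<close>

lemma friedrichs_hartogs_eq:
  assumes f: "f \<in> bergman_space 2 hartogs_triangle"
  shows "friedrichs hartogs_triangle f =
    monomial_combination (\<lambda>k. hartogs_volume / monomial_norm_sq k * cnj (axis_coeff f (2 - k)))"
  unfolding friedrichs_def
proof (rule bergman_projection_hartogs_eqI)
  let ?c = "\<lambda>k. hartogs_volume / monomial_norm_sq k * cnj (axis_coeff f (2 - k))"
  show "(\<lambda>z. cnj (f z)) \<in> borel_measurable hartogs_measure"
    using bergman_2D(2)[OF f] by measurable
  show "integrable hartogs_measure (\<lambda>z. (norm (cnj (f z)))\<^sup>2)"
    using bergman_2D(3)[OF f] by simp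
  fix g assume g: "g \<in> bergman_space 2 hartogs_triangle"
  have int: "integrable hartogs_measure (\<lambda>z. cnj (axis_monomial k z) * g z)" for k
  proof (rule integrable_mult_square_integrable)
    show "(\<lambda>z. cnj (axis_monomial k z)) \<in> borel_measurable hartogs_measure"
      using bergman_2D(2)[OF axis_monomial_bergman[of k]] by measurable
  qed (use bergman_2D[OF g] bergman_2D[OF axis_monomial_bergman[of k]] in auto)
  have "(LINT z|hartogs_measure. cnj (monomial_combination ?c z) * g z)
      = (LINT z|hartogs_measure. (\<Sum>k\<le>2. cnj (?c k) * (cnj (axis_monomial k z) * g z)))"
    by (rule Bochner_Integration.integral_cong)
       (auto simp: monomial_combination_def sum_distrib_right mult.assoc)
  also have "\<dots> = (\<Sum>k\<le>2. cnj (?c k) * (LINT z|hartogs_measure. cnj (axis_monomial k z) * g z))"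
    using int by (subst Bochner_Integration.integral_sum) auto
  also have "\<dots> = (\<Sum>k\<le>2. hartogs_volume * (axis_coeff f (2 - k) * axis_coeff g k))"
  proof (rule sum.cong)
    fix k :: nat assume "k \<in> {..2}"
    then have k: "k \<le> 2" by simp
    show "cnj (?c k) * (LINT z|hartogs_measure. cnj (axis_monomial k z) * g z)
        = hartogs_volume * (axis_coeff f (2 - k) * axis_coeff g k)"
      unfolding integral_cnj_monomial_mult[OF g k]
      using monomial_norm_sq_pos[of k] by simp
  qed simp
  also have "\<dots> = (LINT z|hartogs_measure. f z * g z)"
    by (simp only: integral_mult_eq_sum_axis_coeff[OF f g] sum_distrib_left)
  finally have "cnj (LINT z|hartogs_measure. f z * g z) = cnj (LINT z|hartogs_measure. cnj (monomial_combination ?c z) * g z)"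
    by simp
  then have "(LINT z|hartogs_measure. cnj (f z * g z))
      = (LINT z|hartogs_measure. cnj (cnj (monomial_combination ?c z) * g z))"
    unfolding Bochner_Integration.integral_cnj .
  then show "(LINT z|hartogs_measure. cnj (f z) * cnj (g z))
      = (LINT z|hartogs_measure. monomial_combination ?c z * cnj (g z))"
    by (simp only: complex_cnj_mult complex_cnj_cnj)
next
  show "monomial_combination (\<lambda>k. hartogs_volume / monomial_norm_sq k * cnj (axis_coeff f (2 - k)))
      \<in> bergman_space 2 hartogs_triangle"
    by (rule monomial_combination_bergman)
qed (simp add: monomial_combination_def)

lemma monomial_combination_cong:
  "(\<And>k. k \<le> 2 \<Longrightarrow> c k = d k) \<Longrightarrow> monomial_combination c = monomial_combination d"
  by (auto simp: monomial_combination_def)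

text \<open>
  Each application reverses the indices \<open>0, 1, 2\<close> and conjugates the coefficients; two applications cancel both effects.
\<close>

lemma friedrichs_friedrichs_hartogs_eq:
  assumes f: "f \<in> bergman_space 2 hartogs_triangle"
  shows "friedrichs hartogs_triangle (friedrichs hartogs_triangle f) =
    monomial_combination (\<lambda>k. of_real (hartogs_volume\<^sup>2 / (monomial_norm_sq k * monomial_norm_sq (2 - k))) * axis_coeff f k)"
proof -
  let ?c = "\<lambda>k. hartogs_volume / monomial_norm_sq k * cnj (axis_coeff f (2 - k))"
  have "friedrichs hartogs_triangle (friedrichs hartogs_triangle f)
      = friedrichs hartogs_triangle (monomial_combination ?c)"
    by (simp only: friedrichs_hartogs_eq[OF f])
  also have "\<dots> = monomial_combination
      (\<lambda>k. hartogs_volume / monomial_norm_sq k * cnj (axis_coeff (monomial_combination ?c) (2 - k)))"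
    by (rule friedrichs_hartogs_eq[OF monomial_combination_bergman])
  also have "\<dots> = monomial_combination
     (\<lambda>k. of_real (hartogs_volume\<^sup>2 / (monomial_norm_sq k * monomial_norm_sq (2 - k))) * axis_coeff f k)"
    by (rule monomial_combination_cong)
       (simp add: axis_coeff_monomial_combination power2_eq_square)
  finally show ?thesis .
qed

section \<open>Norm estimates\<close>

lemma lp_norm_hartogs_eq:
  assumes "f \<in> borel_measurable hartogs_measure"
  shows "lp_norm (ereal p) hartogs_triangle f = (LINT z|hartogs_measure. norm (f z) powr p) powr (1 / p)"
proof -
  have "(LINT z|lebesgue_on hartogs_triangle. norm (f z) powr p) = (LINT z|hartogs_measure. norm (f z) powr p)"
    by (rule integral_lebesgue_on_eq_lborel) (use assms in \<open>simp, measurable\<close>)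
  then show ?thesis by (simp add: lp_norm_def)
qed

lemma lp_norm_1_hartogs_eq:
  assumes "f \<in> borel_measurable hartogs_measure"
  shows "lp_norm 1 hartogs_triangle f = (LINT z|hartogs_measure. norm (f z))"
proof -
  have "lp_norm 1 hartogs_triangle f = (LINT z|hartogs_measure. norm (f z) powr 1) powr (1 / 1)"
    using lp_norm_hartogs_eq[OF assms, of 1] by (simp add: one_ereal_def)
  then show ?thesis by simp
qed

text \<open>
  The weight is \<open>1 / \<bar>z\<^sub>2\<bar>\<close> for combinations with a pole and \<open>1\<close> for those without.
\<close>

lemma norm_le_weight_imp_bergman:
  assumes h: "holomorphic_fun_on h hartogs_triangle" and p: "0 < p" and S: "0 \<le> S"
    and w: "\<And>z. 0 \<le> w z" "integrable hartogs_measure (\<lambda>z. w z powr p)"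
    and le: "\<And>z. z \<in> hartogs_triangle \<Longrightarrow> norm (h z) \<le> S * w z"
  shows "h \<in> bergman_space (ereal p) hartogs_triangle"
    and "lp_norm (ereal p) hartogs_triangle h \<le> (LINT z|hartogs_measure. w z powr p) powr (1 / p) * S"
proof -
  note m[measurable] = holomorphic_measurable_hartogs[OF h]
  have le': "norm (h z) powr p \<le> S powr p * w z powr p" if "z \<in> hartogs_triangle" for z
  proof -
    have "norm (h z) powr p \<le> (S * w z) powr p" using p le[OF that] by (intro powr_mono2) auto
    then show ?thesis using S w(1) by (simp add: powr_mult)
  qed
  have intw: "integrable hartogs_measure (\<lambda>z. S powr p * w z powr p)" using w by simp
  have int: "integrable hartogs_measure (\<lambda>z. norm (h z) powr p)"
  proof (rule Bochner_Integration.integrable_bound[OF intw])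
    show "(\<lambda>z. norm (h z) powr p) \<in> borel_measurable hartogs_measure" by measurable
    show "AE z in hartogs_measure. norm (norm (h z) powr p) \<le> norm (S powr p * w z powr p)"
      using le' by (intro AE_I2) simp
  qed
  then show "h \<in> bergman_space (ereal p) hartogs_triangle"
    using h by (simp add: bergman_space_hartogs_iff)
  have "(LINT z|hartogs_measure. norm (h z) powr p) \<le> (LINT z|hartogs_measure. S powr p * w z powr p)"
    by (rule integral_mono[OF int intw]) (simp add: le')
  also have "\<dots> = S powr p * (LINT z|hartogs_measure. w z powr p)" by simp
  finally have "lp_norm (ereal p) hartogs_triangle h
      \<le> (S powr p * (LINT z|hartogs_measure. w z powr p)) powr (1 / p)"
    unfolding lp_norm_hartogs_eq[OF m] using p by (intro powr_mono2) auto
  also have "\<dots> = (S powr p) powr (1 / p) * (LINT z|hartogs_measure. w z powr p) powr (1 / p)"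
    by (rule powr_mult)
  also have "(S powr p) powr (1 / p) = S" using p S by (simp add: powr_powr)
  finally show "lp_norm (ereal p) hartogs_triangle h \<le> (LINT z|hartogs_measure. w z powr p) powr (1 / p) * S"
    by (simp add: mult.commute)
qed

lemma norm_le_imp_bergman_infinity:
  assumes h: "holomorphic_fun_on h hartogs_triangle" and S: "0 \<le> S"
    and le: "\<And>z. z \<in> hartogs_triangle \<Longrightarrow> norm (h z) \<le> S"
  shows "h \<in> bergman_space \<infinity> hartogs_triangle" "lp_norm \<infinity> hartogs_triangle h \<le> S"
proof -
  have m[measurable]: "h \<in> borel_measurable (lebesgue_on hartogs_triangle)"
    by (rule measurable_lebesgue_on_hartogs[OF holomorphic_measurable_hartogs[OF h]])
  have "(\<lambda>z. ereal (norm (h z))) \<in> borel_measurable (lebesgue_on hartogs_triangle)" by measurable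
  then have *: "esssup (lebesgue_on hartogs_triangle) (\<lambda>z. ereal (norm (h z))) \<le> ereal S"
    by (rule esssup_I) (auto intro!: AE_I2 simp: le)
  then show "h \<in> bergman_space \<infinity> hartogs_triangle"
    using h m by (auto simp: bergman_space_def lp_space_def)
  show "lp_norm \<infinity> hartogs_triangle h \<le> S"
    using * S by (cases "esssup (lebesgue_on hartogs_triangle) (\<lambda>z. ereal (norm (h z)))") (auto simp: lp_norm_def)
qed

lemma finite_measure_lebesgue_on_hartogs: "finite_measure (lebesgue_on hartogs_triangle)"
  using bounded_hartogs_triangle open_hartogs_triangle
  by (intro finite_measure_lebesgue_on lmeasurable_open)

lemma bergman_infinity_bound:
  assumes f: "f \<in> bergman_space \<infinity> hartogs_triangle"
  shows "0 \<le> lp_norm \<infinity> hartogs_triangle f"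
    and "AE z in lebesgue_on hartogs_triangle. norm (f z) \<le> lp_norm \<infinity> hartogs_triangle f"
proof -
  let ?M = "lebesgue_on hartogs_triangle" and ?g = "\<lambda>z. ereal (norm (f z))"
  have m[measurable]: "f \<in> borel_measurable ?M" and fin: "esssup ?M ?g < \<infinity>"
    using f by (auto simp: bergman_space_def lp_space_def)
  have "emeasure ?M (space ?M) \<noteq> 0"
    using emeasure_hartogs_pos by (simp add: emeasure_restrict_space emeasure_completion)
  then have "0 = esssup ?M (\<lambda>z. 0::ereal)" by (simp add: esssup_const)
  also have "\<dots> \<le> esssup ?M ?g" by (rule esssup_mono) auto
  finally have nn: "0 \<le> esssup ?M ?g" .
  then have eq: "ereal (lp_norm \<infinity> hartogs_triangle f) = esssup ?M ?g"
    using fin by (cases "esssup ?M ?g") (auto simp: lp_norm_def)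
  then show "0 \<le> lp_norm \<infinity> hartogs_triangle f" using nn by (metis ereal_less_eq(5))
  have "AE z in ?M. ?g z \<le> esssup ?M ?g" by (rule esssup_AE)
  then show "AE z in ?M. norm (f z) \<le> lp_norm \<infinity> hartogs_triangle f"
    unfolding eq[symmetric] by simp
qed

lemma bergman_space_hartogs_mono:
  assumes f: "f \<in> bergman_space p hartogs_triangle" and q: "0 \<le> q" "ereal q \<le> p"
  shows "f \<in> bergman_space (ereal q) hartogs_triangle"
proof (cases p)
  case (real r)
  have h: "holomorphic_fun_on f hartogs_triangle"
    and int: "integrable hartogs_measure (\<lambda>z. norm (f z) powr r)"
    using f by (auto simp: real bergman_space_hartogs_iff)
  have [measurable]: "f \<in> borel_measurable hartogs_measure" by (rule holomorphic_measurable_hartogs[OF h])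
  have "q \<le> r" using q real by simp
  have "integrable hartogs_measure (\<lambda>z. norm (f z) powr q)"
  proof (rule Bochner_Integration.integrable_bound)
    show "integrable hartogs_measure (\<lambda>z. 1 + norm (f z) powr r)"
      using int finite_measure.integrable_const[OF finite_measure_hartogs] by (intro Bochner_Integration.integrable_add)
    show "(\<lambda>z. norm (f z) powr q) \<in> borel_measurable hartogs_measure" by measurable
    have "x powr q \<le> 1 + x powr r" if "0 \<le> x" for x :: real
    proof (cases "x \<le> 1")
      case True
      then have "x powr q \<le> 1 powr q" using that q by (intro powr_mono2) auto
      then show ?thesis by (simp add: add_increasing2)
    next
      case False
      then have "x powr q \<le> x powr r" using \<open>q \<le> r\<close> by (intro powr_mono) auto
      then show ?thesis by simp
    qed
    then show "AE z in hartogs_measure. norm (norm (f z) powr q) \<le> norm (1 + norm (f z) powr r)"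
      by (intro AE_I2) simp
  qed
  then show ?thesis using h by (simp add: bergman_space_hartogs_iff)
next
  case PInf
  have f': "f \<in> bergman_space \<infinity> hartogs_triangle" using f PInf by simp
  then have h: "holomorphic_fun_on f hartogs_triangle"
    and m[measurable]: "f \<in> borel_measurable (lebesgue_on hartogs_triangle)"
    by (auto simp: bergman_space_def lp_space_def)
  have "integrable (lebesgue_on hartogs_triangle) (\<lambda>z. norm (f z) powr q)"
  proof (rule finite_measure.integrable_const_bound[OF finite_measure_lebesgue_on_hartogs])
    show "AE z in lebesgue_on hartogs_triangle. norm (norm (f z) powr q) \<le> lp_norm \<infinity> hartogs_triangle f powr q"
      using bergman_infinity_bound(2)[OF f'] by eventually_elim (use q in \<open>auto intro: powr_mono2\<close>)
  qed measurable
  then show ?thesis using h m by (simp add: bergman_space_def lp_space_def)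
qed (use q in auto)

text \<open>
  The triangle has finite volume. For finite exponents the threshold inequality replaces that of Hoelder, at the
  price of a factor two.
\<close>

lemma lp_norm_1_le_lp_norm:
  assumes p: "1 \<le> p"
  shows "\<exists>C\<ge>0. \<forall>f\<in>bergman_space p hartogs_triangle.
    lp_norm 1 hartogs_triangle f \<le> C * lp_norm p hartogs_triangle f"
proof (cases p)
  case (real r)
  then have r: "1 \<le> r" using p by simp
  let ?V = hartogs_volume
  note V = hartogs_volume_pos
  have "lp_norm 1 hartogs_triangle f \<le> (2 * ?V * (1 / ?V) powr (1 / r)) * lp_norm p hartogs_triangle f"
    if f: "f \<in> bergman_space p hartogs_triangle" for f
  proof -
    have h: "holomorphic_fun_on f hartogs_triangle"
      and int: "integrable hartogs_measure (\<lambda>z. norm (f z) powr r)"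
      using f by (auto simp: real bergman_space_hartogs_iff)
    have m[measurable]: "f \<in> borel_measurable hartogs_measure" by (rule holomorphic_measurable_hartogs[OF h])
    define I where "I = (LINT z|hartogs_measure. norm (f z) powr r)"
    have I0: "0 \<le> I" unfolding I_def by (intro integral_nonneg_AE) auto
    have lp: "lp_norm p hartogs_triangle f = I powr (1 / r)"
      unfolding real I_def by (rule lp_norm_hartogs_eq[OF m])
    have "(LINT z|hartogs_measure. norm (f z)) \<le> 2 * ?V * (1 / ?V) powr (1 / r) * I powr (1 / r)"
    proof (cases "I = 0")
      case True
      then have "AE z in hartogs_measure. norm (f z) powr r = 0"
        using integral_nonneg_eq_0_iff_AE[OF int] by (simp add: I_def)
      then have "AE z in hartogs_measure. norm (f z) = 0" by simp
      then have "(LINT z|hartogs_measure. norm (f z)) = (LINT z|hartogs_measure. 0)"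
        by (intro integral_cong_AE) auto
      then show ?thesis using V by simp
    next
      case False
      \<comment> \<open>this threshold gives both summands the same integral\<close>
      define t where "t = (I / ?V) powr (1 / r)"
      have t: "0 < t" using False I0 V by (simp add: t_def)
      have tr: "t powr r = I / ?V" using r I0 V by (simp add: t_def powr_powr)
      have pt: "norm (f z) \<le> t + t powr (1 - r) * norm (f z) powr r" for z
        by (rule le_threshold_plus_powr) (use t r in auto)
      have intb: "integrable hartogs_measure (\<lambda>z. t + t powr (1 - r) * norm (f z) powr r)"
        using int by (intro Bochner_Integration.integrable_add integrable_mult_right
            finite_measure.integrable_const[OF finite_measure_hartogs])
      have int1: "integrable hartogs_measure (\<lambda>z. norm (f z))"
        by (rule Bochner_Integration.integrable_bound[OF intb])
           (use m in \<open>auto intro!: AE_I2 order_trans[OF pt]\<close>)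
      have "(LINT z|hartogs_measure. norm (f z)) \<le> (LINT z|hartogs_measure. t + t powr (1 - r) * norm (f z) powr r)"
        by (rule integral_mono[OF int1 intb pt])
      also have "\<dots> = t * ?V + t powr (1 - r) * I"
        using int finite_measure.integrable_const[OF finite_measure_hartogs]
        by (subst Bochner_Integration.integral_add)
           (auto simp: I_def measure_hartogs_measure mult.commute)
      also have "t powr (1 - r) * I = t * ?V"
        using t tr V False I0 by (simp add: powr_diff)
      also have "t = (1 / ?V) powr (1 / r) * I powr (1 / r)"
        using V I0 by (simp add: t_def powr_divide)
      finally show ?thesis by (simp add: mult_ac)
    qed
    then show ?thesis by (simp add: lp lp_norm_1_hartogs_eq[OF m])
  qed
  then show ?thesis using V by (intro exI[of _ "2 * ?V * (1 / ?V) powr (1 / r)"]) auto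
next
  case PInf
  let ?M = "lebesgue_on hartogs_triangle"
  interpret finite_measure ?M by (rule finite_measure_lebesgue_on_hartogs)
  have "lp_norm 1 hartogs_triangle f \<le> measure ?M hartogs_triangle * lp_norm p hartogs_triangle f"
    if f: "f \<in> bergman_space p hartogs_triangle" for f
  proof -
    have f': "f \<in> bergman_space \<infinity> hartogs_triangle" using f PInf by simp
    let ?B = "lp_norm \<infinity> hartogs_triangle f"
    have h: "holomorphic_fun_on f hartogs_triangle"
      and m[measurable]: "f \<in> borel_measurable ?M"
      using f' by (auto simp: bergman_space_def lp_space_def)
    have m': "f \<in> borel_measurable hartogs_measure" by (rule holomorphic_measurable_hartogs[OF h])
    have "lp_norm 1 hartogs_triangle f = (LINT z|hartogs_measure. norm (f z))"
      by (rule lp_norm_1_hartogs_eq[OF m'])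
    also have "\<dots> = (LINT z|?M. norm (f z))"
      by (rule integral_lebesgue_on_eq_lborel[symmetric]) (use m' in \<open>simp, measurable\<close>)
    also have "\<dots> \<le> (LINT z|?M. ?B)"
    proof (rule integral_mono_AE)
      show "integrable ?M (\<lambda>z. norm (f z))"
        by (rule integrable_const_bound[of _ ?B]) (use bergman_infinity_bound(2)[OF f'] in auto)
    qed (use bergman_infinity_bound(2)[OF f'] in auto)
    finally show ?thesis using PInf by simp
  qed
  then show ?thesis by (intro exI[of _ "measure ?M hartogs_triangle"]) auto
qed (use p in auto)

text \<open>
  For \<open>k \<ge> 1\<close> the coefficient is a multiple of the integral of \<open>f\<close> against the conjugate of \<open>e\<^sub>k\<close>, which is bounded. For
  \<open>k = 0\<close> the function \<open>e\<^sub>0\<close> is unbounded; instead the bilinear pairing of \<open>f\<close> with the bounded function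
  \<open>e\<^sub>2 = z\<^sub>2\<close> singles out the coefficient.
\<close>

lemma axis_coeff_le_lp_norm_1:
  assumes k: "k \<le> 2"
  shows "\<exists>B\<ge>0. \<forall>f\<in>bergman_space 2 hartogs_triangle. norm (axis_coeff f k) \<le> B * lp_norm 1 hartogs_triangle f"
proof -
  have le: "N * norm a \<le> lp_norm 1 hartogs_triangle f"
    if f: "f \<in> bergman_space 2 hartogs_triangle" and g: "g \<in> borel_measurable hartogs_measure"
      "\<And>z. z \<in> hartogs_triangle \<Longrightarrow> norm (g z) \<le> 1" and N: "0 \<le> N"
      and eq: "(LINT z|hartogs_measure. g z * f z) = of_real N * a" for f g N a
  proof -
    note m[measurable] = bergman_2D(2)[OF f] g(1)
    have f1: "f \<in> bergman_space (ereal 1) hartogs_triangle"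
      by (rule bergman_space_hartogs_mono[OF f]) (auto simp: one_ereal_def[symmetric])
    then have int: "integrable hartogs_measure (\<lambda>z. norm (f z))"
      by (simp add: bergman_space_hartogs_iff)
    have pt: "norm (g z * f z) \<le> norm (f z)" if "z \<in> hartogs_triangle" for z
      using mult_right_mono[OF g(2)[OF that], of "norm (f z)"] by (simp add: norm_mult)
    have "N * norm a = norm (LINT z|hartogs_measure. g z * f z)"
      using N by (simp add: eq norm_mult)
    also have "\<dots> \<le> (LINT z|hartogs_measure. norm (g z * f z))" by (rule integral_norm_bound)
    also have "\<dots> \<le> (LINT z|hartogs_measure. norm (f z))"
    proof (rule integral_mono)
      show "integrable hartogs_measure (\<lambda>z. norm (g z * f z))"
        by (rule Bochner_Integration.integrable_bound[OF int]) (use pt in \<open>auto intro!: AE_I2\<close>)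
    qed (use int pt in auto)
    finally show ?thesis by (simp add: lp_norm_1_hartogs_eq[OF m(1)])
  qed
  show ?thesis
  proof (cases "k = 0")
    case True
    \<comment> \<open>this combination is \<open>z\<^sub>2\<close> on the triangle\<close>
    let ?e = "\<lambda>j. if j = 2 then 1 else (0::complex)"
    have "hartogs_volume * norm (axis_coeff f 0) \<le> lp_norm 1 hartogs_triangle f"
      if f: "f \<in> bergman_space 2 hartogs_triangle" for f
    proof (rule le[OF f])
      show "monomial_combination ?e \<in> borel_measurable hartogs_measure"
        by (rule bergman_2D(2)[OF monomial_combination_bergman])
      show "norm (monomial_combination ?e z) \<le> 1" if "z \<in> hartogs_triangle" for z
        using norm_monomial_combination_le(2)[OF that, of ?e] by (simp add: atMost_2)
      show "(LINT z|hartogs_measure. monomial_combination ?e z * f z) = of_real hartogs_volume * axis_coeff f 0"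
        using integral_mult_eq_sum_axis_coeff[OF f monomial_combination_bergman[of ?e]]
        by (simp add: mult.commute atMost_2 axis_coeff_monomial_combination)
    qed (use hartogs_volume_pos in simp)
    then show ?thesis using hartogs_volume_pos True
      by (intro exI[of _ "1 / hartogs_volume"]) (auto simp: field_simps)
  next
    case False
    have "monomial_norm_sq k * norm (axis_coeff f k) \<le> lp_norm 1 hartogs_triangle f"
      if f: "f \<in> bergman_space 2 hartogs_triangle" for f
    proof (rule le[OF f])
      show "(\<lambda>z. cnj (axis_monomial k z)) \<in> borel_measurable hartogs_measure"
        using bergman_2D(2)[OF axis_monomial_bergman[of k]] by measurable
      show "norm (cnj (axis_monomial k z)) \<le> 1" if "z \<in> hartogs_triangle" for z
        using norm_axis_monomial_le(2)[OF that, of k] False by simp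
      show "(LINT z|hartogs_measure. cnj (axis_monomial k z) * f z) = of_real (monomial_norm_sq k) * axis_coeff f k"
        by (rule integral_cnj_monomial_mult[OF f k])
    qed (use monomial_norm_sq_pos[of k] in simp)
    then show ?thesis using monomial_norm_sq_pos[of k]
      by (intro exI[of _ "1 / monomial_norm_sq k"]) (auto simp: field_simps)
  qed
qed

text \<open>
  All that the norm estimates need about the squared operator: its values lie in the span of the three
  monomials, with coefficients bounded by the \<open>L\<^sup>1\<close> norm and without the singular monomial on \<open>A\<^sup>4\<close>.
\<close>

lemma friedrichs_friedrichs_hartogs:
  obtains K c where "0 < K"
    "\<And>f. f \<in> bergman_space 2 hartogs_triangle \<Longrightarrow>
       friedrichs hartogs_triangle (friedrichs hartogs_triangle f) = monomial_combination (c f)"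
    "\<And>f. f \<in> bergman_space 2 hartogs_triangle \<Longrightarrow>
       (\<Sum>k\<le>2. norm (c f k)) \<le> K * lp_norm 1 hartogs_triangle f"
    "\<And>f. f \<in> bergman_space 2 hartogs_triangle \<Longrightarrow> f \<in> bergman_space 4 hartogs_triangle \<Longrightarrow> c f 0 = 0"
proof -
  define r where "r k = hartogs_volume\<^sup>2 / (monomial_norm_sq k * monomial_norm_sq (2 - k))" for k
  have "\<forall>k\<in>{..2}. \<exists>B\<ge>0. \<forall>f\<in>bergman_space 2 hartogs_triangle.
      norm (axis_coeff f k) \<le> B * lp_norm 1 hartogs_triangle f"
    using axis_coeff_le_lp_norm_1 by auto
  then obtain B where B: "\<And>k. k \<le> 2 \<Longrightarrow> 0 \<le> B k"
    "\<And>k f. k \<le> 2 \<Longrightarrow> f \<in> bergman_space 2 hartogs_triangle \<Longrightarrow>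
      norm (axis_coeff f k) \<le> B k * lp_norm 1 hartogs_triangle f"
    by (metis atMost_iff)
  have r: "0 \<le> r k" for k using monomial_norm_sq_pos[of k] monomial_norm_sq_pos[of "2 - k"]
    by (simp add: r_def)
  \<comment> \<open>adding one makes the constant positive even if all \<open>B k\<close> vanish\<close>
  show ?thesis
  proof (rule that[of "(\<Sum>k\<le>2. r k * B k) + 1" "\<lambda>f k. of_real (r k) * axis_coeff f k"])
    show "0 < (\<Sum>k\<le>2. r k * B k) + 1" using r B by (intro add_nonneg_pos sum_nonneg mult_nonneg_nonneg) auto
    fix f assume f: "f \<in> bergman_space 2 hartogs_triangle"
    show "friedrichs hartogs_triangle (friedrichs hartogs_triangle f)
        = monomial_combination (\<lambda>k. of_real (r k) * axis_coeff f k)"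
      using friedrichs_friedrichs_hartogs_eq[OF f] unfolding r_def .
    have L: "0 \<le> lp_norm 1 hartogs_triangle f"
      unfolding lp_norm_1_hartogs_eq[OF bergman_2D(2)[OF f]] by (intro integral_nonneg_AE) auto
    have "(\<Sum>k\<le>2. norm (of_real (r k) * axis_coeff f k)) \<le> (\<Sum>k\<le>2. (r k * B k) * lp_norm 1 hartogs_triangle f)"
    proof (rule sum_mono)
      fix k :: nat assume "k \<in> {..2}"
      then have "r k * norm (axis_coeff f k) \<le> r k * (B k * lp_norm 1 hartogs_triangle f)"
        using B(2)[OF _ f, of k] r by (intro mult_left_mono) auto
      then show "norm (of_real (r k) * axis_coeff f k) \<le> (r k * B k) * lp_norm 1 hartogs_triangle f"
        using r[of k] by (simp add: norm_mult mult.assoc)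
    qed
    also have "\<dots> = (\<Sum>k\<le>2. r k * B k) * lp_norm 1 hartogs_triangle f"
      by (simp only: sum_distrib_right)
    also have "\<dots> \<le> ((\<Sum>k\<le>2. r k * B k) + 1) * lp_norm 1 hartogs_triangle f"
      using L by (intro mult_right_mono) auto
    finally show "(\<Sum>k\<le>2. norm (of_real (r k) * axis_coeff f k))
        \<le> ((\<Sum>k\<le>2. r k * B k) + 1) * lp_norm 1 hartogs_triangle f" .
    assume "f \<in> bergman_space 4 hartogs_triangle"
    then show "of_real (r 0) * axis_coeff f 0 = 0" using axis_coeff_0_eq_0[OF f] by simp
  qed
qed

lemma friedrichs_square_L1_bound_below_4:
  assumes p: "2 \<le> p" "p < 4"
  shows "\<exists>C>0. \<forall>f\<in>bergman_space 2 hartogs_triangle.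
    friedrichs hartogs_triangle (friedrichs hartogs_triangle f) \<in> bergman_space p hartogs_triangle \<and>
    lp_norm p hartogs_triangle (friedrichs hartogs_triangle (friedrichs hartogs_triangle f))
      \<le> C * lp_norm 1 hartogs_triangle f"
proof -
  obtain q where q: "p = ereal q" "2 \<le> q" "q < 4" using p by (cases p) auto
  obtain K c where K: "0 < K" and F2: "\<And>f. f \<in> bergman_space 2 hartogs_triangle \<Longrightarrow>
       friedrichs hartogs_triangle (friedrichs hartogs_triangle f) = monomial_combination (c f)"
    and c: "\<And>f. f \<in> bergman_space 2 hartogs_triangle \<Longrightarrow>
       (\<Sum>k\<le>2. norm (c f k)) \<le> K * lp_norm 1 hartogs_triangle f"
    using friedrichs_friedrichs_hartogs by metis
  define D where "D = (LINT z|hartogs_measure. (1 / norm (z $ 2)) powr q) powr (1 / q)"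
  have D: "0 \<le> D" by (simp add: D_def)
  show ?thesis
  proof (intro exI[of _ "D * K + 1"] conjI ballI)
    show "0 < D * K + 1" using D K by (intro add_nonneg_pos mult_nonneg_nonneg) auto
    fix f assume f: "f \<in> bergman_space 2 hartogs_triangle"
    have L: "0 \<le> lp_norm 1 hartogs_triangle f"
      unfolding lp_norm_1_hartogs_eq[OF bergman_2D(2)[OF f]] by (intro integral_nonneg_AE) auto
    have w: "integrable hartogs_measure (\<lambda>z. (1 / norm (z $ 2)) powr q)"
      by (rule integrable_inverse_second_coord_powr) (use q in auto)
    have q0: "0 < q" using q by simp
    note est = norm_le_weight_imp_bergman[OF monomial_combination_holomorphic q0 sum_nonneg _ w
        norm_monomial_combination_le(1)[of _ "c f"]]
    show "friedrichs hartogs_triangle (friedrichs hartogs_triangle f) \<in> bergman_space p hartogs_triangle"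
      unfolding F2[OF f] q by (rule est(1)) auto
    have "lp_norm p hartogs_triangle (monomial_combination (c f)) \<le> D * (\<Sum>k\<le>2. norm (c f k))"
      unfolding q D_def by (rule est(2)) auto
    also have "\<dots> \<le> D * (K * lp_norm 1 hartogs_triangle f)"
      by (rule mult_left_mono[OF c[OF f] D])
    also have "\<dots> \<le> (D * K + 1) * lp_norm 1 hartogs_triangle f"
      using L by (simp add: algebra_simps)
    finally show "lp_norm p hartogs_triangle (friedrichs hartogs_triangle (friedrichs hartogs_triangle f))
      \<le> (D * K + 1) * lp_norm 1 hartogs_triangle f"
      unfolding F2[OF f] .
  qed
qed

lemma friedrichs_square_L1_bound_from_4:
  assumes p: "4 \<le> p"
  shows "\<exists>C>0. \<forall>f\<in>bergman_space 4 hartogs_triangle.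
    friedrichs hartogs_triangle (friedrichs hartogs_triangle f) \<in> bergman_space p hartogs_triangle \<and>
    lp_norm p hartogs_triangle (friedrichs hartogs_triangle (friedrichs hartogs_triangle f))
      \<le> C * lp_norm 1 hartogs_triangle f"
proof -
  obtain K c where K: "0 < K" and F2: "\<And>f. f \<in> bergman_space 2 hartogs_triangle \<Longrightarrow>
       friedrichs hartogs_triangle (friedrichs hartogs_triangle f) = monomial_combination (c f)"
    and c: "\<And>f. f \<in> bergman_space 2 hartogs_triangle \<Longrightarrow>
       (\<Sum>k\<le>2. norm (c f k)) \<le> K * lp_norm 1 hartogs_triangle f"
    and c0: "\<And>f. f \<in> bergman_space 2 hartogs_triangle \<Longrightarrow> f \<in> bergman_space 4 hartogs_triangle \<Longrightarrow> c f 0 = 0"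
    using friedrichs_friedrichs_hartogs by metis
  define D where "D = (if p = \<infinity> then 1 else hartogs_volume powr (1 / real_of_ereal p))"
  have D: "0 \<le> D" by (simp add: D_def)
  show ?thesis
  proof (intro exI[of _ "D * K + 1"] conjI ballI)
    show "0 < D * K + 1" using D K by (intro add_nonneg_pos mult_nonneg_nonneg) auto
    fix f assume f4: "f \<in> bergman_space 4 hartogs_triangle"
    have f: "f \<in> bergman_space 2 hartogs_triangle"
      using bergman_space_hartogs_mono[OF f4, of 2] by simp
    have L: "0 \<le> lp_norm 1 hartogs_triangle f"
      unfolding lp_norm_1_hartogs_eq[OF bergman_2D(2)[OF f]] by (intro integral_nonneg_AE) auto
    let ?S = "\<Sum>k\<le>2. norm (c f k)"
    have S: "0 \<le> ?S" by (intro sum_nonneg) auto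
    note bd = norm_monomial_combination_le(2)[of _ "c f", OF _ c0[OF f f4]]
    have est: "monomial_combination (c f) \<in> bergman_space p hartogs_triangle \<and>
        lp_norm p hartogs_triangle (monomial_combination (c f)) \<le> D * ?S"
    proof (cases p)
      case (real q)
      then have q: "0 < q" using p by simp
      have w: "integrable hartogs_measure (\<lambda>z. 1 powr q)"
        using finite_measure.integrable_const[OF finite_measure_hartogs] by simp
      have le: "norm (monomial_combination (c f) z) \<le> ?S * 1" if "z \<in> hartogs_triangle" for z
        using bd[OF that] by simp
      from norm_le_weight_imp_bergman[OF monomial_combination_holomorphic q S _ w le]
      show ?thesis using real by (simp add: D_def measure_hartogs_measure)
    next
      case PInf
      then show ?thesis
        using norm_le_imp_bergman_infinity[OF monomial_combination_holomorphic S bd] by (simp add: D_def)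
    qed (use p in auto)
    then show "friedrichs hartogs_triangle (friedrichs hartogs_triangle f) \<in> bergman_space p hartogs_triangle"
      unfolding F2[OF f] by simp
    have "lp_norm p hartogs_triangle (monomial_combination (c f)) \<le> D * ?S" using est by simp
    also have "\<dots> \<le> D * (K * lp_norm 1 hartogs_triangle f)"
      by (rule mult_left_mono[OF c[OF f] D])
    also have "\<dots> \<le> (D * K + 1) * lp_norm 1 hartogs_triangle f"
      using L by (simp add: algebra_simps)
    finally show "lp_norm p hartogs_triangle (friedrichs hartogs_triangle (friedrichs hartogs_triangle f))
      \<le> (D * K + 1) * lp_norm 1 hartogs_triangle f"
      unfolding F2[OF f] .
  qed
qed

text \<open>
  On a domain of finite volume an \<open>L\<^sup>1\<close> bound is stronger than a bound by any other \<open>L\<^sup>q\<close> norm.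
\<close>

lemma bounded_bergman_operator_if_L1_bound:
  assumes q: "1 \<le> q"
    and sub: "bergman_space q hartogs_triangle \<subseteq> A"
    and bound: "\<exists>C>0. \<forall>f\<in>A. T f \<in> bergman_space p hartogs_triangle \<and>
      lp_norm p hartogs_triangle (T f) \<le> C * lp_norm 1 hartogs_triangle f"
  shows "bounded_bergman_operator hartogs_triangle q p T"
proof -
  obtain C where C: "0 < C" "\<And>f. f \<in> A \<Longrightarrow> T f \<in> bergman_space p hartogs_triangle"
    "\<And>f. f \<in> A \<Longrightarrow> lp_norm p hartogs_triangle (T f) \<le> C * lp_norm 1 hartogs_triangle f"
    using bound by auto
  obtain C' where C': "\<And>f. f \<in> bergman_space q hartogs_triangle \<Longrightarrow>
      lp_norm 1 hartogs_triangle f \<le> C' * lp_norm q hartogs_triangle f"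
    using lp_norm_1_le_lp_norm[OF q] by auto
  have "lp_norm p hartogs_triangle (T f) \<le> (C * C') * lp_norm q hartogs_triangle f"
    if f: "f \<in> bergman_space q hartogs_triangle" for f
  proof -
    have "lp_norm p hartogs_triangle (T f) \<le> C * lp_norm 1 hartogs_triangle f"
      using C(3) sub f by auto
    also have "\<dots> \<le> C * (C' * lp_norm q hartogs_triangle f)"
      using C(1) C'[OF f] by (intro mult_left_mono) auto
    finally show ?thesis by (simp add: mult.assoc)
  qed
  then show ?thesis
    unfolding bounded_bergman_operator_def using C(2) sub by auto
qed

theorem proposition3p12:
  defines "F2 \<equiv> friedrichs hartogs_triangle \<circ> friedrichs hartogs_triangle"
  shows "(\<forall>p\<in>{2..\<infinity>}. bounded_bergman_operator hartogs_triangle p p F2) \<and>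
    (\<forall>p\<in>{2..<4}. bounded_bergman_operator hartogs_triangle 2 p F2 \<and>
       (\<exists>C>0. \<forall>f\<in>bergman_space 2 hartogs_triangle.
          lp_norm p hartogs_triangle (F2 f) \<le> C * lp_norm 1 hartogs_triangle f)) \<and>
    (\<forall>p\<in>{4..\<infinity>}. bounded_bergman_operator hartogs_triangle 4 p F2 \<and>
       (\<exists>C>0. \<forall>f\<in>bergman_space 4 hartogs_triangle.
          lp_norm p hartogs_triangle (F2 f) \<le> C * lp_norm 1 hartogs_triangle f))"
proof -
  have low: "\<exists>C>0. \<forall>f\<in>bergman_space 2 hartogs_triangle. F2 f \<in> bergman_space p hartogs_triangle \<and>
      lp_norm p hartogs_triangle (F2 f) \<le> C * lp_norm 1 hartogs_triangle f" if "2 \<le> p" "p < 4" for p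
    using friedrichs_square_L1_bound_below_4[OF that] unfolding F2_def o_apply .
  have high: "\<exists>C>0. \<forall>f\<in>bergman_space 4 hartogs_triangle. F2 f \<in> bergman_space p hartogs_triangle \<and>
      lp_norm p hartogs_triangle (F2 f) \<le> C * lp_norm 1 hartogs_triangle f" if "4 \<le> p" for p
    using friedrichs_square_L1_bound_from_4[OF that] unfolding F2_def o_apply .
  have sub: "bergman_space p hartogs_triangle \<subseteq> bergman_space q hartogs_triangle"
    if "q = 2 \<or> q = 4" "q \<le> p" for p q
  proof
    fix f assume f: "f \<in> bergman_space p hartogs_triangle"
    have "q = ereal (real_of_ereal q)" "0 \<le> real_of_ereal q" using that(1) by auto
    then show "f \<in> bergman_space q hartogs_triangle"
      using bergman_space_hartogs_mono[OF f, of "real_of_ereal q"] that(2) by simp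
  qed
  have one: "(1::ereal) \<le> 2" "(1::ereal) \<le> 4" by simp_all
  have "bounded_bergman_operator hartogs_triangle p p F2" if "2 \<le> p" for p
  proof (cases "p < 4")
    case True
    show ?thesis
      by (rule bounded_bergman_operator_if_L1_bound[OF order_trans[OF one(1) that] sub low])
         (use that True in auto)
  next
    case False
    then have "4 \<le> p" by simp
    then show ?thesis
      by (intro bounded_bergman_operator_if_L1_bound[OF order_trans[OF one(1) that] sub high]) auto
  qed
  moreover have "bounded_bergman_operator hartogs_triangle 2 p F2" if "2 \<le> p" "p < 4" for p
    by (rule bounded_bergman_operator_if_L1_bound[OF one(1) subset_refl low[OF that]])
  moreover have "bounded_bergman_operator hartogs_triangle 4 p F2" if "4 \<le> p" for p
    by (rule bounded_bergman_operator_if_L1_bound[OF one(2) subset_refl high[OF that]])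
  moreover have "\<exists>C>0. \<forall>f\<in>bergman_space 2 hartogs_triangle.
      lp_norm p hartogs_triangle (F2 f) \<le> C * lp_norm 1 hartogs_triangle f" if "2 \<le> p" "p < 4" for p
    using low[OF that] by blast
  moreover have "\<exists>C>0. \<forall>f\<in>bergman_space 4 hartogs_triangle.
      lp_norm p hartogs_triangle (F2 f) \<le> C * lp_norm 1 hartogs_triangle f" if "4 \<le> p" for p
    using high[OF that] by blast
  ultimately show ?thesis by auto
qed

end
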